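(* Let $0<|q|<1$ and let $a,b,c,d$ be complex numbers with $|q/b|<1$ such that no denominator below vanishes. Then \begin{align*} &\sum_{k=0}^\infty\frac{1-aq^{2k}}{1-a} \frac{(a,b,c,d,ab/c,ab/d;q)_k} {(q,aq/b,aq/c,aq/d,cq/b,dq/b;q)_k} \frac{(aq/b;q)_{2k}}{(ab;q)_{2k}}\Big(\frac qb\Big)^{k}\\ &=\frac{(aq,ab/c,ab/d,aq/cd;q)_\infty} {(ab,aq/c,aq/d,ab/cd;q)_\infty}\sum_{k=0}^\infty \frac{(b,c,d,cd/a;q)_k} {(q,cq/b,dq/b,cdq/ab;q)_k}\Big(\frac qb\Big)^{2k}\\ &\quad+ \frac{(aq,c,d,cdq/ab^2;q)_\infty} {(ab,cq/b,dq/b,cd/ab;q)_\infty}\sum_{k=0}^\infty \frac{(b,ab/c,ab/d,ab^2/cd;q)_k} {(q,aq/c,aq/d,abq/cd;q)_k}\Big(\frac qb\Big)^{2k}. \end{align*}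
   Context: For complex $x$ and $0<|q|<1$: $(x;q)_\infty=\prod_{j\ge0}(1-xq^j)$, $(x;q)_k=(x;q)_\infty/(xq^k;q)_\infty$ (so $(x;q)_k=\prod_{j=0}^{k-1}(1-xq^j)$ for integers $k\ge0$), and $(x_1,\dots,x_m;q)_k=(x_1;q)_k\cdots(x_m;q)_k$ for $k$ an integer or $\infty$. *)

theory Defs
  imports "HOL-Analysis.Analysis"
begin

definition qpoch_inf :: "complex \<Rightarrow> complex \<Rightarrow> complex" where
  "qpoch_inf x q = (\<Prod>j. 1 - x * q ^ j)"

text \<open>
  For a natural number \<open>k\<close> the finite product is the definition. The quotient
  \<open>(x;q)\<^sub>\<infinity> / (x q^k;q)\<^sub>\<infinity>\<close> takes the form \<open>0/0\<close> when \<open>x = q^(-m)\<close> for some \<open>m \<ge> k\<close>, which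
  HOL evaluates to \<open>0\<close>; the lemma \<open>qpoch_eq_quotient\<close> below shows that the two agree otherwise.
\<close>

definition qpoch :: "complex \<Rightarrow> complex \<Rightarrow> nat \<Rightarrow> complex" where
  "qpoch x q k = (\<Prod>j<k. 1 - x * q ^ j)"

definition qpochs_inf :: "complex list \<Rightarrow> complex \<Rightarrow> complex" where
  "qpochs_inf xs q = (\<Prod>x\<leftarrow>xs. qpoch_inf x q)"

definition qpochs :: "complex list \<Rightarrow> complex \<Rightarrow> nat \<Rightarrow> complex" where
  "qpochs xs q k = (\<Prod>x\<leftarrow>xs. qpoch x q k)"

lemma convergent_prod_qpoch:
  fixes x q :: complex
  assumes "norm q < 1"
  shows "convergent_prod (\<lambda>j. 1 - x * q ^ j)"
proof -
  have "summable (\<lambda>j. norm x * norm q ^ j)"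
    using assms by (intro summable_mult summable_geometric) auto
  hence "summable (\<lambda>j. norm ((1 - x * q ^ j) - 1))"
    by (simp add: norm_mult norm_power)
  hence "abs_convergent_prod (\<lambda>j. 1 - x * q ^ j)"
    by (simp add: abs_convergent_prod_conv_summable)
  thus ?thesis by (rule abs_convergent_prod_imp_convergent_prod)
qed

lemma qpoch_mult_inf:
  assumes "norm q < 1"
  shows "qpoch x q k * qpoch_inf (x * q ^ k) q = qpoch_inf x q"
proof -
  have lim: "(\<lambda>n. \<Prod>j<n. 1 - y * q ^ j) \<longlonglongrightarrow> qpoch_inf y q" for y
    unfolding qpoch_inf_def
    using convergent_prod_has_prod[OF convergent_prod_qpoch[OF assms]]
    by (rule has_prod_imp_tendsto')
  have split: "(\<Prod>j<n + k. 1 - x * q ^ j)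
      = qpoch x q k * (\<Prod>j<n. 1 - (x * q ^ k) * q ^ j)" for n
    unfolding qpoch_def by (induction n) (simp_all add: power_add mult_ac)
  have "(\<lambda>n. qpoch x q k * (\<Prod>j<n. 1 - (x * q ^ k) * q ^ j))
      \<longlonglongrightarrow> qpoch x q k * qpoch_inf (x * q ^ k) q"
    by (intro tendsto_mult tendsto_const lim)
  moreover have "(\<lambda>n. qpoch x q k * (\<Prod>j<n. 1 - (x * q ^ k) * q ^ j)) \<longlonglongrightarrow> qpoch_inf x q"
    using LIMSEQ_ignore_initial_segment[OF lim[of x], of k] unfolding split .
  ultimately show ?thesis by (rule LIMSEQ_unique)
qed

lemma qpoch_eq_quotient:
  assumes "norm q < 1" and "qpoch_inf (x * q ^ k) q \<noteq> 0"
  shows "qpoch x q k = qpoch_inf x q / qpoch_inf (x * q ^ k) q"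
  using qpoch_mult_inf[OF assms(1), of x k] assms(2) by (simp add: field_simps)

end

theory Submission
  imports Defs "HOL-Complex_Analysis.Conformal_Mappings"
begin

text \<open>
  Put \<open>A = ab\<close> and \<open>\<beta> = 1/b\<close>. With \<open>A\<close>, \<open>c\<close>, \<open>d\<close> fixed, both sides of the identity, cleared of finitely many
  infinite products, are holomorphic in \<open>|\<beta>| < 1/|q|\<close>, the origin included. Hence it suffices to treat
  \<open>\<beta> = q^n\<close>, that is \<open>b = q^(-n)\<close>, where all three series terminate.

  In the terminating case, both sides (cleared of denominators) are polynomials of degree at most \<open>4n+1\<close>
  in \<open>c\<close>. The poles at \<open>cd/A = q^s\<close>, \<open>|s| \<le> n\<close>, cancel between the two sums on the right, which gives \<open>2n+1\<close> zeros
  of the difference; another \<open>2n+1\<close> come from \<open>c = q^(-l)\<close>, \<open>0 \<le> l \<le> 2n\<close>, and the same argument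
  in \<open>d\<close> leaves the case \<open>c = q^(-l)\<close>, \<open>d = q^(-m)\<close>.

  There the identity reads \<open>S l m = G l m\<close> for two symmetric matrices, where \<open>S\<close> is given by an LDU-type
  decomposition and \<open>G\<close> resembles the linearization coefficients of Rogers' polynomials. Both satisfy the same
  four-term recurrence: for \<open>S\<close> termwise, because the factors are generalized eigenvectors of a pair of bidiagonal
  operators, for \<open>G\<close> by creative telescoping. The recurrence says nothing about the diagonal \<open>l = m\<close>;
  this gap is closed by descending from \<open>m = l + n\<close>, where both sums reduce to a single term.
\<close>

section \<open>Elementary rules for finite q-shifted factorials\<close>

lemma qpoch_0 [simp]: "qpoch x q 0 = 1"
  by (simp add: qpoch_def)

lemma qpoch_Suc: "qpoch x q (Suc k) = qpoch x q k * (1 - x * q ^ k)"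
  by (simp add: qpoch_def)

lemma qpoch_add: "qpoch x q (i + j) = qpoch x q i * qpoch (x * q ^ i) q j"
  by (induction j) (simp_all add: qpoch_Suc power_add mult_ac)

lemma qpoch_Suc_left: "qpoch x q (Suc k) = (1 - x) * qpoch (x * q) q k"
  using qpoch_add[of x q 1 k] by (simp add: qpoch_Suc)

lemma qpoch_eq_0_iff: "qpoch x q k = 0 \<longleftrightarrow> (\<exists>j<k. x * q ^ j = 1)"
  by (auto simp: qpoch_def)

subsection \<open>The terminating case at powers of \<open>q\<close>\<close>

lemma qpoch_self_nz:
  fixes q :: complex
  assumes "norm q < 1"
  shows "qpoch q q k \<noteq> 0"
proof -
  have "norm (q * q ^ j) < 1" for j
    using power_Suc_less_one[of "norm q" j] assms by (cases "q = 0") (auto simp: norm_mult norm_power)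
  hence "q * q ^ j \<noteq> 1" for j by (metis less_irrefl norm_one)
  thus ?thesis by (auto simp: qpoch_eq_0_iff)
qed

section \<open>The sequence \<open>(b;q)_k / (q;q)_k\<close> for b = q^(-n)\<close>

locale terminating_sums =
  fixes q b :: complex and n :: nat
  assumes q_nz: "q \<noteq> 0" and q_lt_1: "norm q < 1" and b_eq: "b * q ^ n = 1"
begin

lemma q_power_neq_1: "j > 0 \<Longrightarrow> q ^ j \<noteq> 1"
  using q_lt_1 by (metis norm_one norm_power power_Suc_less_one gr0_implies_Suc norm_ge_zero
      less_irrefl q_nz zero_less_norm_iff)

lemma b_nz: "b \<noteq> 0"
  using b_eq by auto

lemma b_neq_q_power: "j > 0 \<Longrightarrow> b \<noteq> q ^ j"
  using b_eq q_power_neq_1[of "j + n"] by (auto simp: power_add)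

lemma qpoch_q_nz: "qpoch q q k \<noteq> 0"
  using q_lt_1 by (rule qpoch_self_nz)

definition p :: complex where "p = b / q"

lemma p_nz: "p \<noteq> 0"
  using b_nz q_nz by (simp add: p_def)

definition h :: "nat \<Rightarrow> complex" where "h j = qpoch b q j / qpoch q q j"

text \<open>
  \<open>hh l k\<close> is \<open>h (l - k)\<close> with \<open>h = 0\<close> at negative arguments; with this convention the recurrence of \<open>h\<close>
  holds across the boundary \<open>k = l\<close>.
\<close>
definition hh :: "nat \<Rightarrow> nat \<Rightarrow> complex" where "hh l k = (if k \<le> l then h (l - k) else 0)"

lemma h_0 [simp]: "h 0 = 1"
  by (simp add: h_def)

lemma h_Suc: "(1 - q ^ Suc j) * h (Suc j) = (1 - b * q ^ j) * h j"
  using qpoch_q_nz[of j] q_power_neq_1[of "Suc j"]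
  by (simp add: h_def qpoch_Suc)

text \<open>As q is not a root of unity, b q^i = 1 only at i = n, so the numerator (q^(-n);q)_j
  acquires its single zero factor exactly when j exceeds n.\<close>

lemma h_eq_0_iff: "h j = 0 \<longleftrightarrow> j > n"
proof -
  have "b * q ^ i = 1 \<longleftrightarrow> i = n" for i
  proof
    assume "b * q ^ i = 1"
    hence *: "q ^ i = q ^ n"
      using b_eq b_nz by (metis mult_left_cancel)
    show "i = n"
    proof (rule ccontr)
      assume "i \<noteq> n"
      then consider "i < n" | "n < i" by linarith
      thus False
      proof cases
        case 1
        thus False using * q_power_neq_1[of "n - i"] q_nz
          by (metis div_self power_diff power_not_zero less_imp_le zero_less_diff)
      next
        case 2
        thus False using * q_power_neq_1[of "i - n"] q_nz
          by (metis div_self power_diff power_not_zero less_imp_le zero_less_diff)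
      qed
    qed
  qed (use b_eq in auto)
  thus ?thesis
    using qpoch_q_nz[of j] by (auto simp: h_def qpoch_eq_0_iff)
qed

text \<open>The recurrence of \<open>h\<close> solved without division: both neighbours are explicit
  multiples of a common \<open>s\<close>. At k = l + 1 the value \<open>s\<close> = 1/(1 - b/q)
  still serves, since b is not q.\<close>

lemma hh_factor:
  assumes "k \<le> Suc l"
  obtains s where "hh (Suc l) k = (1 - b * q ^ l / q ^ k) * s"
    and "hh l k = (1 - q ^ Suc l / q ^ k) * s"
proof (cases "k = Suc l")
  case True
  have "1 - b / q \<noteq> 0"
    using b_neq_q_power[of 1] q_nz by auto
  thus ?thesis
    using True q_nz by (intro that[of "1 / (1 - b / q)"]) (auto simp: hh_def)
next
  case False
  with assms have k: "k \<le> l" by simp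
  define s where "s = h (l - k) / (1 - q ^ Suc (l - k))"
  have nz: "1 - q ^ Suc (l - k) \<noteq> 0"
    using q_power_neq_1[of "Suc (l - k)"] by simp
  have 1: "q ^ Suc l / q ^ k = q ^ Suc (l - k)" and 2: "q ^ l / q ^ k = q ^ (l - k)"
    using k q_nz by (auto simp: power_diff)
  have "hh (Suc l) k = (1 - b * q ^ (l - k)) * s"
    using h_Suc[of "l - k"] nz k by (simp add: hh_def s_def Suc_diff_le field_simps)
  moreover have "hh l k = (1 - q ^ Suc (l - k)) * s"
    using nz k by (simp add: hh_def s_def)
  ultimately show ?thesis
    using that[of s] 1 2 by (metis times_divide_eq_right)
qed

end

text \<open>
  Creative telescoping for \<open>G\<close> below; \<open>K\<close>, \<open>L\<close>, \<open>M\<close> stand for \<open>q^k\<close>, \<open>q^l\<close>, \<open>q^m\<close>.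
\<close>
lemma telescoping_certificate:
  fixes q b a K L M :: complex
  assumes "q \<noteq> 0" "b \<noteq> 0" "K \<noteq> 0" "L \<noteq> 0" "M \<noteq> 0"
  shows "((1/(q*L) + a*(q*L)) - (1/(q*M) + a*(q*M))) * (1 - b*L/K) * (1 - b*M/K)
          * (1 - a*b*q*L*M/K) * (1 - a*b*L*M/K)
      - b/q * ((1/(b*L) + a*b*L) - (1/(q*M) + a*(q*M))) * (1 - q*L/K) * (1 - b*M/K)
          * (1 - a*b*L*M/K) * (1 - a*q^2*L*M/K)
      - b/q * ((1/(q*L) + a*(q*L)) - (1/(b*M) + a*b*M)) * (1 - b*L/K) * (1 - q*M/K)
          * (1 - a*b*L*M/K) * (1 - a*q^2*L*M/K)
      + (b/q)^2 * ((1/(b*L) + a*b*L) - (1/(b*M) + a*b*M)) * (1 - q*L/K) * (1 - q*M/K)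
          * (1 - a*q^2*L*M/K) * (1 - a*q*L*M/K)
    = a * (b/q - 1) * (M - L) / K * (b/q * (1 - b*K) * (1 - q*L/K) * (1 - q*M/K) * (1 - a*q^2*L*M/K)
        - q * (1 - K) * (1 - b*L/K) * (1 - b*M/K) * (1 - a*b*L*M/K))"
  using assms by (simp add: divide_simps) algebra

text \<open>Because b = q^(-n), factors in ab are factors in a shifted by n places. Excluding all
  integer powers of q for a therefore keeps (aq;q)_j, (ab;q)_j and the differences of the spectral
  values below away from 0.\<close>

locale generic_terminating_sums = terminating_sums +
  fixes a :: complex
  assumes a_nz: "a \<noteq> 0" and a_generic: "\<And>i j::nat. a * q ^ i \<noteq> q ^ j"
begin

lemma one_minus_a_nz: "1 - a * q ^ i \<noteq> 0"
  using a_generic[of i 0] by auto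

lemma ab_q_power_nz: "1 - a * b * q ^ i \<noteq> 0"
proof
  assume "1 - a * b * q ^ i = 0"
  hence "a * q ^ i * (b * q ^ n) = q ^ n"
    by (simp add: algebra_simps)
  thus False
    using a_generic[of i n] b_eq by simp
qed

lemma qpoch_aq_nz: "qpoch (a * q) q j \<noteq> 0"
  using one_minus_a_nz[of "Suc _"] by (auto simp: qpoch_eq_0_iff mult_ac)

lemma qpoch_ab_nz: "qpoch (a * b) q j \<noteq> 0"
  using ab_q_power_nz by (auto simp: qpoch_eq_0_iff)

definition g :: "nat \<Rightarrow> complex" where "g j = qpoch (a * b) q j / qpoch (a * q) q j"

lemma g_0 [simp]: "g 0 = 1"
  by (simp add: g_def)

definition V :: "nat \<Rightarrow> complex" where
  "V k = (1 - a * q ^ (2 * k)) / (1 - a) * (qpoch a q k * qpoch b q k / qpoch q q k)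
     * (qpoch (a * q ^ (n + k + 1)) q k / qpoch (a * b) q (2 * k)) * p ^ k"

definition S :: "nat \<Rightarrow> nat \<Rightarrow> complex" where
  "S l m = (\<Sum>k\<le>n. V k * (hh l k * g (l + k)) * (hh m k * g (m + k)))"

definition G :: "nat \<Rightarrow> nat \<Rightarrow> complex" where
  "G l m = (\<Sum>k\<le>n. p ^ k * h k * hh l k * hh m k * g (l + m - k))"

text \<open>\<open>al\<close> and \<open>ga\<close> are values of x + a/x, at x = q^(-l) and at x =
  1/(b q^l). Differences of such values factor as (x - y)(1 - a/(xy)).\<close>

definition al :: "nat \<Rightarrow> complex" where "al l = 1 / q ^ l + a * q ^ l"

definition ga :: "nat \<Rightarrow> complex" where "ga l = 1 / (b * q ^ l) + a * b * q ^ l"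

lemma S_commute: "S l m = S m l"
  by (simp add: S_def mult_ac)

lemma G_commute: "G l m = G m l"
  by (simp add: G_def mult_ac add.commute)

text \<open>Rearranged, this says that u_l = \<open>hh l k * g (l + k)\<close> satisfies
  \<open>al (Suc l)\<close> u_(l+1) - p \<open>ga l\<close> u_l = \<open>al k\<close> (u_(l+1) - p
  u_l): a generalized eigenvector with eigenvalue \<open>al k\<close>.\<close>

lemma hh_g_step:
  "(al (Suc l) - al k) * (hh (Suc l) k * g (Suc l + k)) = p * (ga l - al k) * (hh l k * g (l + k))"
proof (cases "k \<le> Suc l")
  case True
  then obtain s where s: "hh (Suc l) k = (1 - b * q ^ l / q ^ k) * s" "hh l k = (1 - q ^ Suc l / q ^ k) * s"
    by (rule hh_factor)
  have nz: "1 - a * q * q ^ (l + k) \<noteq> 0"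
    using one_minus_a_nz[of "Suc (l + k)"] by (simp add: mult_ac)
  define W where "W = qpoch (a * b) q (l + k) / qpoch (a * q) q (Suc (l + k))"
  have g: "g (Suc l + k) = W * (1 - a * b * q ^ l * q ^ k)" "g (l + k) = W * (1 - a * q * q ^ l * q ^ k)"
    using nz qpoch_aq_nz[of "l + k"] by (simp_all add: g_def W_def qpoch_Suc power_add mult_ac)
  have *: "(1/(q*L) + a*(q*L) - (1/K + a*K)) * ((1 - b*L/K) * (1 - a*b*L*K))
      = b/q * (1/(b*L) + a*b*L - (1/K + a*K)) * ((1 - q*L/K) * (1 - a*q*L*K))"
    if "L \<noteq> 0" "K \<noteq> 0" for L K
    using that q_nz b_nz by (simp add: divide_simps) algebra
  show ?thesis
    using arg_cong[OF *[of "q ^ l" "q ^ k"], of "\<lambda>x. x * (s * W)"] q_nz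
    unfolding s g al_def ga_def p_def by (simp add: mult_ac)
qed (simp add: hh_def)

text \<open>In each term the eigenvalue \<open>al k\<close> can be produced from the factor in l or
  from the factor in m. Equating the two results eliminates it, so the remaining relation is
  independent of k and can be summed.\<close>

lemma S_recurrence:
  "(al (Suc l) - al (Suc m)) * S (Suc l) (Suc m) - p * (ga l - al (Suc m)) * S l (Suc m)
     - p * (al (Suc l) - ga m) * S (Suc l) m + p ^ 2 * (ga l - ga m) * S l m = 0"
proof -
  have "(al (Suc l) - al (Suc m)) * (V k * x * y) - p * (ga l - al (Suc m)) * (V k * x' * y)
     - p * (al (Suc l) - ga m) * (V k * x * y') + p ^ 2 * (ga l - ga m) * (V k * x' * y') = 0"
    if x: "(al (Suc l) - al k) * x = p * (ga l - al k) * x'"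
      and y: "(al (Suc m) - al k) * y = p * (ga m - al k) * y'" for k x x' y y'
  proof -
    have x: "al (Suc l) * x - p * ga l * x' = al k * (x - p * x')"
      and y: "al (Suc m) * y - p * ga m * y' = al k * (y - p * y')"
      using x y by (simp_all add: algebra_simps)
    have "(al (Suc l) * x - p * ga l * x') * (y - p * y') = (x - p * x') * (al (Suc m) * y - p * ga m * y')"
      unfolding x y by simp
    thus ?thesis
      by algebra
  qed
  from this[OF hh_g_step hh_g_step] show ?thesis
    unfolding S_def sum_distrib_left sum_subtractf[symmetric] sum.distrib[symmetric]
    by (intro sum.neutral ballI)
qed

lemma G_recurrence:
  assumes "l \<noteq> m"
  shows "(al (Suc l) - al (Suc m)) * G (Suc l) (Suc m) - p * (ga l - al (Suc m)) * G l (Suc m)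
     - p * (al (Suc l) - ga m) * G (Suc l) m + p ^ 2 * (ga l - ga m) * G l m = 0"
proof -
  define t where "t = (\<lambda>l m k. p ^ k * h k * hh l k * hh m k * g (l + m - k))"
  \<comment> \<open>The telescoping certificate: the summand of the recurrence is the forward
    difference of \<open>C\<close>.\<close>
  define C where "C = (\<lambda>k. a * (p - 1) * (q ^ m - q ^ l) * q / q ^ k * (1 - q ^ k) * (p ^ k * h k)
    * hh (Suc l) k * hh (Suc m) k * (qpoch (a * b) q (Suc (l + m) - k) / qpoch (a * q) q (Suc (Suc (l + m)) - k)))"
  have "(al (Suc l) - al (Suc m)) * t (Suc l) (Suc m) k - p * (ga l - al (Suc m)) * t l (Suc m) k
     - p * (al (Suc l) - ga m) * t (Suc l) m k + p ^ 2 * (ga l - ga m) * t l m k = C (Suc k) - C k" for k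
  proof (cases "k \<le> Suc l \<and> k \<le> Suc m")
    case True
    then obtain s s' where s: "hh (Suc l) k = (1 - b * q ^ l / q ^ k) * s" "hh l k = (1 - q ^ Suc l / q ^ k) * s"
      and s': "hh (Suc m) k = (1 - b * q ^ m / q ^ k) * s'" "hh m k = (1 - q ^ Suc m / q ^ k) * s'"
      using hh_factor by metis
    \<comment> \<open>For distinct l and m, min l m + 1 is at most l + m, so the truncated
      subtraction l + m - k is a true one.\<close>
    have "k \<le> l + m" using True \<open>l \<noteq> m\<close> by linarith
    define N where "N = l + m - k"
    define W where "W = qpoch (a * b) q N / qpoch (a * q) q (Suc (Suc N))"
    define K L M where "K = q ^ k" and "L = q ^ l" and "M = q ^ m"
    have nz: "K \<noteq> 0" "L \<noteq> 0" "M \<noteq> 0"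
      using q_nz by (simp_all add: K_def L_def M_def)
    have qN: "q ^ N = L * M / K"
      using \<open>k \<le> l + m\<close> q_nz by (simp add: N_def K_def L_def M_def power_diff power_add)
    have idx: "Suc (l + m) - k = Suc N" "Suc (Suc (l + m)) - k = Suc (Suc N)" "l + m - k = N"
      "l + m - Suc k = N - 1" "Suc l + Suc m - k = Suc (Suc N)" "l + Suc m - k = Suc N" "Suc l + m - k = Suc N"
      "Suc (l + m) - Suc k = N" "Suc (Suc (l + m)) - Suc k = Suc N"
      using \<open>k \<le> l + m\<close> by (simp_all add: N_def)
    have nz1: "1 - a * q^2 * L * M / K \<noteq> 0" and nz2: "1 - a * q * L * M / K \<noteq> 0"
      using one_minus_a_nz[of "Suc (Suc N)"] one_minus_a_nz[of "Suc N"]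
      by (simp_all add: qN mult_ac power2_eq_square)
    have aq: "qpoch (a * q) q (Suc N) = qpoch (a * q) q N * (1 - a * q * L * M / K)"
      "qpoch (a * q) q (Suc (Suc N)) = qpoch (a * q) q N * (1 - a * q * L * M / K) * (1 - a * q^2 * L * M / K)"
      by (simp_all add: qpoch_Suc qN power2_eq_square mult_ac)
    have ab: "qpoch (a * b) q (Suc N) = qpoch (a * b) q N * (1 - a * b * L * M / K)"
      "qpoch (a * b) q (Suc (Suc N)) = qpoch (a * b) q N * (1 - a * b * L * M / K) * (1 - a * b * q * L * M / K)"
      by (simp_all add: qpoch_Suc qN mult_ac)
    have gs: "g (Suc (Suc N)) = W * (1 - a*b*L*M/K) * (1 - a*b*q*L*M/K)"
      "g (Suc N) = W * (1 - a*b*L*M/K) * (1 - a*q^2*L*M/K)"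
      "g N = W * (1 - a*q*L*M/K) * (1 - a*q^2*L*M/K)"
      "qpoch (a * b) q (Suc N) / qpoch (a * q) q (Suc (Suc N)) = W * (1 - a*b*L*M/K)"
      "qpoch (a * b) q N / qpoch (a * q) q (Suc N) = W * (1 - a*q^2*L*M/K)"
      using nz1 nz2 qpoch_aq_nz[of N] unfolding g_def W_def ab aq by auto
    have hS: "(1 - q * K) * h (Suc k) = (1 - b * K) * h k"
      using h_Suc[of k] by (simp add: K_def)
    have hhS: "hh (Suc l) (Suc k) = hh l k" "hh (Suc m) (Suc k) = hh m k"
      by (simp_all add: hh_def)
    have CS: "C (Suc k) = a * (p - 1) * (M - L) / K * (p * (1 - b * K) * (1 - q*L/K) * (1 - q*M/K) * (1 - a*q^2*L*M/K))
        * (p ^ k * h k * s * s' * W)"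
    proof -
      have "C (Suc k) = a * (p - 1) * (M - L) / K * (p * p ^ k) * ((1 - q * K) * h (Suc k)) * hh l k * hh m k
              * (W * (1 - a*q^2*L*M/K))"
        unfolding C_def idx gs hhS using q_nz by (simp add: K_def L_def M_def)
      thus ?thesis
        unfolding hS s s' by (simp add: K_def L_def M_def mult_ac)
    qed
    have C0: "C k = a * (p - 1) * (M - L) / K * (q * (1 - K) * (1 - b*L/K) * (1 - b*M/K) * (1 - a*b*L*M/K))
        * (p ^ k * h k * s * s' * W)"
      unfolding C_def idx gs s s' by (simp add: K_def L_def M_def mult_ac)
    \<comment> \<open>The four values of \<open>t\<close> and the two of \<open>C\<close> share the
      factor \<open>p ^ k * h k * s * s' * W\<close>; \<open>scale\<close> multiplies the
      certificate by it, with everything else opaque.\<close>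
    have scale: "c1 * (P * H * (u * s) * (v * s') * (W * x * y)) - p * c2 * (P * H * (u' * s) * (v * s') * (W * x * z))
        - p * c3 * (P * H * (u * s) * (v' * s') * (W * x * z)) + p^2 * c4 * (P * H * (u' * s) * (v' * s') * (W * w * z))
        = e * (p * f * u' * v' * z) * (P * H * s * s' * W) - e * (q * f' * u * v * x) * (P * H * s * s' * W)"
      if "c1 * u * v * y * x - p * c2 * u' * v * x * z - p * c3 * u * v' * x * z + p^2 * c4 * u' * v' * z * w
        = e * (p * f * u' * v' * z - q * f' * u * v * x)" for c1 c2 c3 c4 P H u v u' v' w x y z e f f'
      using that by algebra
    show ?thesis
      unfolding CS C0 t_def idx gs s s' al_def ga_def power_Suc K_def L_def M_def
      by (rule scale, rule telescoping_certificate[OF q_nz b_nz nz, of a, folded p_def, unfolded K_def L_def M_def])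
  next
    case False
    thus ?thesis
      by (auto simp: t_def C_def hh_def)
  qed
  hence "(al (Suc l) - al (Suc m)) * G (Suc l) (Suc m) - p * (ga l - al (Suc m)) * G l (Suc m)
     - p * (al (Suc l) - ga m) * G (Suc l) m + p ^ 2 * (ga l - ga m) * G l m = (\<Sum>k\<le>n. C (Suc k) - C k)"
    unfolding G_def sum_distrib_left sum_subtractf[symmetric] sum.distrib[symmetric] t_def
    by (intro sum.cong refl)
  also have "\<dots> = C (Suc n) - C 0"
    by (simp only: sum_lessThan_telescope flip: lessThan_Suc_atMost)
  \<comment> \<open>\<open>C 0\<close> contains 1 - q^0, and \<open>C (Suc n)\<close> contains
    \<open>h (Suc n)\<close>, which is 0.\<close>
  also have "\<dots> = 0"
    using h_eq_0_iff[of "Suc n"] by (simp add: C_def)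
  finally show ?thesis .
qed

text \<open>For \<open>l + n \<le> m\<close>, at most the term \<open>k = l\<close> survives on either side.\<close>
lemma S_eq_G_last:
  assumes "l + n \<le> m"
  shows "S l m = G l m"
proof -
  have zero: "hh l k * hh m k = 0" if "k \<noteq> l \<or> l + n < m" for k
    using that assms h_eq_0_iff[of "m - k"] by (auto simp: hh_def)
  show ?thesis
  proof (cases "l + n = m \<and> l \<le> n")
    case False
    have "V k * (hh l k * g (l + k)) * (hh m k * g (m + k)) = 0" if "k \<le> n" for k
      using zero[of k] that False assms by auto
    moreover have "p ^ k * h k * hh l k * hh m k * g (l + m - k) = 0" if "k \<le> n" for k
      using zero[of k] that False assms by auto
    ultimately show ?thesis
      unfolding S_def G_def by (metis (no_types, lifting) atMost_iff sum.neutral)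
  next
    case True
    hence m: "m = l + n" and "l \<le> n" by auto
    have "S l m = (\<Sum>k\<in>{l}. V k * (hh l k * g (l + k)) * (hh m k * g (m + k)))"
      unfolding S_def using zero \<open>l \<le> n\<close> by (intro sum.mono_neutral_right) auto
    also have "\<dots> = V l * g (l + l) * h n * g (m + l)"
      by (simp add: hh_def m)
    also have "\<dots> = p ^ l * h l * h n * g m"
    proof -
      \<comment> \<open>Here m = l + n enters: ab q^m = a q^l, so the last l factors of (ab;q)_(m+l)
        match the last l factors of (a;q)_(2l).\<close>
      have abm: "qpoch (a * b) q (m + l) = qpoch (a * b) q m * qpoch (a * q ^ l) q l"
      proof -
        have "a * b * q ^ m = a * q ^ l * (b * q ^ n)"
          by (simp add: m power_add)
        thus ?thesis
          by (simp only: qpoch_add b_eq mult_1_right)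
      qed
      have aqm: "qpoch (a * q) q (m + l) = qpoch (a * q) q m * qpoch (a * q ^ (n + l + 1)) q l"
        by (simp add: qpoch_add m power_add mult_ac)
      have a2: "qpoch a q (l + l) = qpoch a q l * qpoch (a * q ^ l) q l"
        by (rule qpoch_add)
      have "(1 - a) * qpoch (a * q) q (l + l) = qpoch a q (1 + (l + l))"
        unfolding qpoch_add[of a q 1] by (simp add: qpoch_Suc)
      also have "\<dots> = qpoch a q (l + l) * (1 - a * q ^ (l + l))"
        by (simp add: qpoch_Suc)
      finally have a3: "(1 - a) * qpoch (a * q) q (l + l) = qpoch a q l * qpoch (a * q ^ l) q l * (1 - a * q ^ (l + l))"
        unfolding a2 .
      have nz: "qpoch (a * q ^ (n + l + 1)) q l \<noteq> 0"
        using qpoch_aq_nz[of "m + l"] aqm by auto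
      have cancel: "A1 / A0 * (Pa * Pb / Pq) * (X / AB) * P * (AB / AQ) * H * (ABm * Y / (AQm * X))
          = P * (Pb / Pq) * H * (ABm / AQm)"
        if "A0 * AQ = Pa * Y * A1" "A0 \<noteq> 0" "AQ \<noteq> 0" "X \<noteq> 0" "AB \<noteq> 0"
        for A0 A1 Pa Pb Pq X AB P AQ H ABm Y AQm :: complex
      proof -
        have "A1 / A0 * (Pa * Pb / Pq) * (X / AB) * P * (AB / AQ) * H * (ABm * Y / (AQm * X))
            = (Pa * Y * A1) / (A0 * AQ) * (P * (Pb / Pq) * H * (ABm / AQm))"
          using that(4,5) by (simp add: mult_ac)
        thus ?thesis
          using that(2,3) unfolding that(1)[symmetric] by simp
      qed
      show ?thesis
        unfolding V_def g_def h_def[of l] abm aqm mult_2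
        by (rule cancel) (use a3 one_minus_a_nz[of 0] qpoch_aq_nz qpoch_ab_nz nz in \<open>simp_all add: mult_ac\<close>)
    qed
    also have "\<dots> = (\<Sum>k\<in>{l}. p ^ k * h k * hh l k * hh m k * g (l + m - k))"
      by (simp add: hh_def m)
    also have "\<dots> = G l m"
      unfolding G_def using zero \<open>l \<le> n\<close> by (intro sum.mono_neutral_left) auto
    finally show ?thesis .
  qed
qed

lemma S_eq_G_0: "S 0 m = G 0 m"
proof -
  have "S 0 m = (\<Sum>k\<in>{0}. V k * (hh 0 k * g (0 + k)) * (hh m k * g (m + k)))"
    unfolding S_def by (intro sum.mono_neutral_right) (auto simp: hh_def)
  also have "\<dots> = (\<Sum>k\<in>{0}. p ^ k * h k * hh 0 k * hh m k * g (0 + m - k))"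
    using one_minus_a_nz[of 0] by (simp add: V_def hh_def)
  also have "\<dots> = G 0 m"
    unfolding G_def by (intro sum.mono_neutral_left) (auto simp: hh_def)
  finally show ?thesis .
qed

text \<open>The difference factors, and its only dangerous factor vanishes just when q^(l+n) = q^m.
  This is the coefficient by which the descent in \<open>S_eq_G\<close> divides.\<close>

lemma al_neq_ga:
  assumes "m < l + n"
  shows "al l \<noteq> ga m"
proof
  assume eq: "al l = ga m"
  have "al l - ga m = (1 - q ^ l / (b * q ^ m)) * (1 - a * b * q ^ l * q ^ m) / q ^ l"
    using q_nz b_nz by (simp add: al_def ga_def field_simps)
  moreover have "1 - a * b * q ^ l * q ^ m \<noteq> 0"
    using ab_q_power_nz[of "l + m"] by (simp add: power_add mult_ac)
  moreover have "1 - q ^ l / (b * q ^ m) \<noteq> 0"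
  proof
    assume "1 - q ^ l / (b * q ^ m) = 0"
    hence "q ^ l * q ^ n = (b * q ^ n) * q ^ m"
      using b_nz q_nz by (simp add: field_simps)
    hence "q ^ (l + n) = q ^ m"
      using b_eq by (simp add: power_add)
    moreover have "q ^ (l + n) = q ^ m * q ^ (l + n - m)"
      using assms by (simp flip: power_add)
    ultimately show False
      using q_power_neq_1[of "l + n - m"] assms q_nz by auto
  qed
  ultimately show False
    using eq q_nz by auto
qed

text \<open>Induction on l, with symmetry for m < l. For m at least l the recurrence at (l - 1, m)
  is solved for the entry (l, m) in terms of (l, m + 1) and row l - 1, descending from m = l + n.
  There l - 1 differs from m, so \<open>G_recurrence\<close> applies even when the entry is
  diagonal.\<close>

lemma S_eq_G: "S l m = G l m"
proof (induction l arbitrary: m rule: less_induct)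
  case (less l)
  show ?case
  proof (cases "l = 0 \<or> m < l")
    case True
    thus ?thesis
      using S_eq_G_0 less.IH[of m l] S_commute[of l m] G_commute[of l m] by auto
  next
    case False
    then obtain l' where l: "l = Suc l'" and "m \<ge> l"
      by (cases l) auto
    show ?thesis
    proof (cases "l + n \<le> m")
      case False
      hence "m \<le> l + n" by simp
      from this \<open>m \<ge> l\<close> show ?thesis
      proof (induction m rule: inc_induct)
        case base
        show ?case by (rule S_eq_G_last) simp
      next
        case (step m)
        from step obtain m' where m: "m = Suc m'" "l' \<noteq> m"
          using l by (cases m) auto
        have "p * (al l - ga m) * S l m = (al l - al (Suc m)) * S l (Suc m) - p * (ga l' - al (Suc m)) * S l' (Suc m)
            + p ^ 2 * (ga l' - ga m) * S l' m"
          using S_recurrence[of l' m] unfolding l[symmetric] by (simp add: algebra_simps)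
        also have "\<dots> = (al l - al (Suc m)) * G l (Suc m) - p * (ga l' - al (Suc m)) * G l' (Suc m)
            + p ^ 2 * (ga l' - ga m) * G l' m"
          using step less.IH[of l'] l by simp
        also have "\<dots> = p * (al l - ga m) * G l m"
          using G_recurrence[OF \<open>l' \<noteq> m\<close>] unfolding l[symmetric] by (simp add: algebra_simps)
        finally show ?case
          using p_nz al_neq_ga[of m l] step by simp
      qed
    qed (rule S_eq_G_last)
  qed
qed

end

subsection \<open>The terminating case\<close>

lemma power_power_swap: "(x ^ i) ^ j = (x ^ j) ^ i" for x :: complex
  by (metis power_mult mult.commute)

text \<open>Each factor obeys (1 - 1/(y q^i)) y = -(1 - y q^i)/q^i; the product is read in reverse
  order.\<close>

lemma qpoch_reflect:
  fixes q y :: complex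
  assumes "q \<noteq> 0" "y \<noteq> 0"
  shows "qpoch (1 / (y * q ^ k)) q (Suc k) * y ^ Suc k = (\<Prod>i\<le>k. - 1 / q ^ i) * qpoch y q (Suc k)"
proof (induction k)
  case 0
  show ?case using assms by (simp add: qpoch_Suc field_simps)
next
  case (Suc k)
  have "qpoch (1 / (y * q ^ Suc k)) q (Suc (Suc k)) * y ^ Suc (Suc k)
      = ((1 - 1 / (y * q ^ Suc k)) * y) * (qpoch (1 / (y * q ^ k)) q (Suc k) * y ^ Suc k)"
    using assms by (subst qpoch_Suc_left) (simp add: mult_ac)
  also have "(1 - 1 / (y * q ^ Suc k)) * y = - 1 / q ^ Suc k * (1 - y * q ^ Suc k)"
    using assms by (simp add: field_simps)
  finally show ?case
    unfolding Suc.IH by (simp add: qpoch_Suc[of y q "Suc k"] mult_ac)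
qed

lemma tendsto_qpoch [tendsto_intros]:
  assumes "(f \<longlongrightarrow> l) F"
  shows "((\<lambda>x. qpoch (f x) q k) \<longlongrightarrow> qpoch l q k) F"
  unfolding qpoch_def using assms by (intro tendsto_intros)

text \<open>
  \<open>poly_bound m f\<close>: away from \<open>0\<close>, the function \<open>f\<close> is a polynomial of degree at most \<open>m\<close>.
\<close>
definition poly_bound :: "nat \<Rightarrow> (complex \<Rightarrow> complex) \<Rightarrow> bool" where
  "poly_bound m f \<longleftrightarrow> (\<exists>P. degree P \<le> m \<and> (\<forall>c. c \<noteq> 0 \<longrightarrow> f c = poly P c))"

lemma poly_bound_const: "poly_bound 0 (\<lambda>_. x)"
  unfolding poly_bound_def by (intro exI[of _ "[:x:]"]) auto

lemma poly_bound_mult: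
  assumes "poly_bound m f" "poly_bound m' f'"
  shows "poly_bound (m + m') (\<lambda>c. f c * f' c)"
proof -
  from assms obtain P P' where "degree P \<le> m" "\<And>c. c \<noteq> 0 \<Longrightarrow> f c = poly P c"
    "degree P' \<le> m'" "\<And>c. c \<noteq> 0 \<Longrightarrow> f' c = poly P' c"
    unfolding poly_bound_def by blast
  thus ?thesis
    unfolding poly_bound_def using degree_mult_le[of P P'] by (intro exI[of _ "P * P'"]) auto
qed

lemma poly_bound_cmult: "poly_bound m f \<Longrightarrow> poly_bound m (\<lambda>c. x * f c)"
  using poly_bound_mult[OF poly_bound_const[of x]] by simp

lemma poly_bound_add:
  assumes "poly_bound m f" "poly_bound m f'"
  shows "poly_bound m (\<lambda>c. f c + f' c)"
proof -
  from assms obtain P P' where "degree P \<le> m" "\<And>c. c \<noteq> 0 \<Longrightarrow> f c = poly P c"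
    "degree P' \<le> m" "\<And>c. c \<noteq> 0 \<Longrightarrow> f' c = poly P' c"
    unfolding poly_bound_def by blast
  thus ?thesis
    unfolding poly_bound_def by (intro exI[of _ "P + P'"]) (auto intro: degree_add_le)
qed

lemma poly_bound_mono: "poly_bound m f \<Longrightarrow> m \<le> m' \<Longrightarrow> poly_bound m' f"
  unfolding poly_bound_def by (meson order_trans)

lemma poly_bound_sum:
  "(\<And>k. k \<in> K \<Longrightarrow> poly_bound m (f k)) \<Longrightarrow> poly_bound m (\<lambda>c. \<Sum>k\<in>K. f k c)"
  by (induction K rule: infinite_finite_induct)
     (auto intro: poly_bound_add poly_bound_mono[OF poly_bound_const])

lemma poly_bound_qpoch: "poly_bound k (\<lambda>c. qpoch (c * t) q k)"
proof (induction k)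
  case 0
  show ?case using poly_bound_const by simp
next
  case (Suc k)
  have "poly_bound 1 (\<lambda>c. 1 - c * t * q ^ k)"
    unfolding poly_bound_def by (intro exI[of _ "[:1, - (t * q ^ k):]"]) (auto simp: algebra_simps)
  from poly_bound_mult[OF Suc this] show ?case
    by (simp add: qpoch_Suc)
qed

lemma poly_bound_qpoch_inverse: "poly_bound k (\<lambda>c. c ^ k * qpoch (t / c) q k)"
proof (induction k)
  case 0
  show ?case using poly_bound_const by simp
next
  case (Suc k)
  have "poly_bound 1 (\<lambda>c. c * (1 - t / c * q ^ k))"
    unfolding poly_bound_def by (intro exI[of _ "[:- (t * q ^ k), 1:]"]) (auto simp: algebra_simps)
  from poly_bound_mult[OF Suc this] show ?case
    by (simp add: qpoch_Suc mult_ac)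
qed

lemma poly_bound_eq_0:
  assumes "poly_bound m f" "m < card Z" "\<And>z. z \<in> Z \<Longrightarrow> z \<noteq> 0 \<and> f z = 0" "c \<noteq> 0"
  shows "f c = 0"
proof -
  obtain P where P: "degree P \<le> m" "\<And>c. c \<noteq> 0 \<Longrightarrow> f c = poly P c"
    using assms(1) unfolding poly_bound_def by blast
  have "poly P z = poly 0 z" if "z \<in> Z" for z
    using assms(3)[OF that] P(2)[of z] by simp
  hence "P = 0"
    using P(1) assms(2) by (intro poly_eqI_degree[of Z]) auto
  thus ?thesis
    using P(2) assms(4) by simp
qed

section \<open>Both sides as polynomials, and cancellation of the poles in cd/A\<close>

context terminating_sums
begin

text \<open>
  \<open>N k x = (x;q)\<^sub>k / (qx/b;q)\<^sub>k\<close> times \<open>(qx/b;q)\<^sub>n\<close>, which makes it a polynomial of degree \<open>n\<close> for \<open>k \<le> n\<close>.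
\<close>
definition N :: "nat \<Rightarrow> complex \<Rightarrow> complex" where
  "N k x = qpoch x q k * qpoch (x * q ^ (n + 1 + k)) q (n - k)"

text \<open>As q/b = q^(n+1), \<open>N k x\<close> is (x;q)_(2n+1) with the n + 1 consecutive
  factors from index k on removed.\<close>

lemma N_mult:
  assumes "k \<le> n"
  shows "N k x * qpoch (x * q ^ k) q (n + 1) = qpoch x q (2 * n + 1)"
proof -
  have "2 * n + 1 = k + ((n + 1) + (n - k))" using assms by simp
  thus ?thesis
    by (simp only: qpoch_add N_def) (simp add: power_add mult_ac)
qed

text \<open>Up to sign and a power of q, \<open>h j\<close> is the Gaussian binomial coefficient of
  n over j; this is its symmetry under j -> n - j.\<close>

lemma h_reflect:
  assumes "j \<le> n"
  shows "h (n - j) = h n * h j / p ^ j"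
  using assms
proof (induction j)
  case (Suc j)
  define i where "i = n - Suc j"
  have i: "n - j = Suc i" "n = Suc (i + j)"
    using Suc.prems by (auto simp: i_def)
  have "b * q ^ i * q ^ Suc j = 1" "b * q ^ j * q ^ Suc i = 1"
    using b_eq by (simp_all add: i(2) power_add mult_ac)
  hence bi: "b * q ^ i = 1 / q ^ Suc j" and bj: "b * q ^ j = 1 / q ^ Suc i"
    using q_nz by (simp_all add: field_simps)
  have pq: "1 / p = q ^ Suc j * q ^ Suc i"
    using b_eq b_nz q_nz by (simp add: p_def i(2) power_add field_simps)
  have nzi: "1 - q ^ Suc i \<noteq> 0" and nzj: "1 - q ^ Suc j \<noteq> 0"
    using q_power_neq_1[of "Suc i"] q_power_neq_1[of "Suc j"] by auto
  have "h (Suc j) = (1 - 1 / q ^ Suc i) * h j / (1 - q ^ Suc j)"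
    using h_Suc[of j] nzj unfolding bj by (simp add: field_simps)
  hence hj: "h j = h (Suc j) * (1 - q ^ Suc j) / (1 - 1 / q ^ Suc i)"
    using nzi nzj q_nz by (simp add: field_simps)
  have "h i = (1 - q ^ Suc i) * h (Suc i) / (1 - 1 / q ^ Suc j)"
    using h_Suc[of i] nzj q_nz unfolding bi by (simp add: field_simps)
  also have "h (Suc i) = h n * h j / p ^ j"
    using Suc i by simp
  also have "(1 - q ^ Suc i) * (h n * h j / p ^ j) / (1 - 1 / q ^ Suc j)
     = h n * h (Suc j) / p ^ j * (((1 - q ^ Suc i) / (1 - 1 / q ^ Suc i)) * ((1 - q ^ Suc j) / (1 - 1 / q ^ Suc j)))"
    unfolding hj by (simp add: mult_ac)
  also have "(1 - x) / (1 - 1 / x) = - x" if "x \<noteq> 0" "1 - x \<noteq> 0" for x :: complex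
    using that by (simp add: field_simps)
  from this[of "q ^ Suc i"] this[of "q ^ Suc j"]
  have "((1 - q ^ Suc i) / (1 - 1 / q ^ Suc i)) * ((1 - q ^ Suc j) / (1 - 1 / q ^ Suc j)) = 1 / p"
    unfolding pq using q_nz nzi nzj by simp
  finally show ?case
    by (simp add: i_def)
qed simp

lemma h_n_nz: "h n \<noteq> 0"
  by (simp add: h_eq_0_iff)

lemma h_n_squared: "h n ^ 2 = p ^ n"
  using h_reflect[of n] p_nz by (simp add: field_simps power2_eq_square)

text \<open>The product does not depend on y in \<open>qpoch_reflect\<close>, so it can be evaluated
  at y = q, where both factorials are known.\<close>

lemma reflection_sign: "(\<Prod>i\<le>n. - 1 / q ^ i) = - h n"
proof -
  have b: "b = 1 / q ^ n"
    using b_eq q_nz by (simp add: field_simps)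
  have nz: "1 - q ^ Suc n \<noteq> 0"
    using q_power_neq_1[of "Suc n"] by simp
  have "qpoch (1 / (q * q ^ n)) q (Suc n) * q ^ Suc n = ((1 - 1 / q ^ Suc n) * q ^ Suc n) * qpoch b q n"
    using q_nz by (subst qpoch_Suc_left) (simp add: b mult_ac)
  also have "(1 - 1 / q ^ Suc n) * q ^ Suc n = - (1 - q ^ Suc n)"
    using q_nz by (simp add: field_simps)
  finally have "(\<Prod>i\<le>n. - 1 / q ^ i) * qpoch q q (Suc n) = - (1 - q ^ Suc n) * qpoch b q n"
    unfolding qpoch_reflect[OF q_nz q_nz, of n] .
  moreover have "(1 - x) * (s * Q + B) = 0" if "s * (Q * (1 - x)) = - (1 - x) * B" for x s Q B :: complex
    using that by algebra
  ultimately have "(1 - q ^ Suc n) * ((\<Prod>i\<le>n. - 1 / q ^ i) * qpoch q q n + qpoch b q n) = 0"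
    unfolding qpoch_Suc power_Suc by blast
  hence "(\<Prod>i\<le>n. - 1 / q ^ i) * qpoch q q n = - qpoch b q n"
    using nz by (simp add: eq_neg_iff_add_eq_0)
  thus ?thesis
    using qpoch_q_nz[of n] by (simp add: h_def field_simps)
qed

text \<open>At x = q^(-i), \<open>N k x\<close> and \<open>hh i k * p ^ k\<close> obey the same
  first-order recurrence in k up to min i n, hence are proportional there. For larger k up to n both
  vanish.\<close>

lemma N_at_q_power:
  assumes "i \<le> 2 * n"
  obtains \<nu> where "\<And>k. k \<le> n \<Longrightarrow> N k (1 / q ^ i) = \<nu> * hh i k * p ^ k"
proof -
  \<comment> \<open>The constant is fixed at the top index, where i - K is at most n and so
    \<open>hh i K\<close> is nonzero; at k = 0 the value \<open>h i\<close> vanishes once i >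
    n.\<close>
  define K where "K = min i n"
  have "hh i K \<noteq> 0"
    using assms h_eq_0_iff[of "i - K"] by (auto simp: hh_def K_def)
  define \<nu> where "\<nu> = N K (1 / q ^ i) / (hh i K * p ^ K)"
  have below: "N k (1 / q ^ i) = \<nu> * hh i k * p ^ k" if "k \<le> K" for k
    using that
  proof (induction k rule: inc_induct)
    case base
    show ?case using \<open>hh i K \<noteq> 0\<close> p_nz by (simp add: \<nu>_def)
  next
    case (step k)
    hence k: "k < i" "k < n" by (auto simp: K_def)
    define x where "x = 1 / q ^ i"
    define j where "j = i - Suc k"
    have j: "i - k = Suc j" "i = Suc (j + k)" using k by (auto simp: j_def)
    have "n - k = Suc (n - Suc k)" using k by simp
    hence Nk: "N (Suc k) x * (1 - x * q ^ (n + 1 + k)) = N k x * (1 - x * q ^ k)"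
      unfolding N_def by (simp only: qpoch_Suc_left[of "x * q ^ (n + 1 + k)"] qpoch_Suc[of x]) (simp add: mult_ac)
    have xk: "x * q ^ k = 1 / q ^ Suc j"
      using q_nz by (simp add: x_def j(2) power_add)
    have xnk: "x * q ^ (n + 1 + k) = 1 / (b * q ^ j)"
    proof -
      have "b * q ^ j * (x * q ^ (n + 1 + k)) = (b * q ^ n) * (q ^ i / q ^ i)"
        by (simp add: x_def j(2) power_add)
      thus ?thesis using b_eq q_nz b_nz by (simp add: field_simps)
    qed
    have nz: "1 - 1 / q ^ Suc j \<noteq> 0" "1 - q ^ Suc j \<noteq> 0"
      using q_power_neq_1[of "Suc j"] q_nz by auto
    have hhk: "hh i k = h (Suc j)" "hh i (Suc k) = h j"
      using k by (simp_all add: hh_def j)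
    have "N k x * (1 - 1 / q ^ Suc j) = \<nu> * p ^ k * (p * (1 - 1 / (b * q ^ j)) * h j)"
      using Nk step.IH unfolding xk xnk hhk x_def[symmetric] by (simp add: mult_ac)
    also have "p * (1 - 1 / (b * q ^ j)) * h j = - ((1 - b * q ^ j) * h j) / q ^ Suc j"
      using b_nz q_nz by (simp add: p_def field_simps)
    also have "\<dots> = h (Suc j) * (1 - 1 / q ^ Suc j)"
      unfolding h_Suc[symmetric] using q_nz by (simp add: field_simps)
    finally have "N k x = \<nu> * p ^ k * h (Suc j)"
      using nz by simp
    thus ?case
      by (simp add: x_def hhk)
  qed
  have "N k (1 / q ^ i) = \<nu> * hh i k * p ^ k" if "k \<le> n" for k
  proof (cases "k \<le> K")
    case False
    hence "i < k" using that by (auto simp: K_def)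
    hence "qpoch (1 / q ^ i) q k = 0"
      using q_nz by (auto simp: qpoch_eq_0_iff)
    thus ?thesis
      using \<open>i < k\<close> by (simp add: N_def hh_def)
  qed (rule below)
  thus ?thesis by (rule that)
qed

text \<open>The part of the k-th left-hand term free of c and d, with a = A q^n; (aq/b;q)_k has been
  cancelled against (aq/b;q)_(2k), and 1/p^k is (q/b)^k.\<close>

definition v :: "complex \<Rightarrow> nat \<Rightarrow> complex" where
  "v A k = (1 - A * q ^ (n + 2 * k)) / (1 - A * q ^ n) * (qpoch (A * q ^ n) q k * qpoch b q k / qpoch q q k)
     * (qpoch (A * q ^ (2 * n + k + 1)) q k / qpoch A q (2 * k)) / p ^ k"

text \<open>
  The left-hand side and the first summand of the right-hand side, both multiplied by
  \<open>(cq/b, dq/b, aq/c, aq/d; q)\<^sub>n\<close>, where \<open>a = A/b\<close>. The second summand is the first one at \<open>A/c\<close>, \<open>A/d\<close>.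
\<close>
definition LL :: "complex \<Rightarrow> complex \<Rightarrow> complex \<Rightarrow> complex" where
  "LL A c d = (\<Sum>k\<le>n. v A k * N k c * N k d * N k (A / c) * N k (A / d))"

definition TT :: "complex \<Rightarrow> complex \<Rightarrow> complex \<Rightarrow> complex" where
  "TT A c d = qpoch (A / c) q (2 * n + 1) * qpoch (A / d) q (2 * n + 1) / qpoch A q (n + 1)
     * (\<Sum>k\<le>n. h k / p ^ k * N k c * N k d / qpoch (A / (c * d * q ^ k)) q (n + 1))"

text \<open>
  \<open>Psi A c d\<close> is \<open>LL A c d - TT A c d - TT A (A/c) (A/d)\<close> cleared of the poles at \<open>c d = A q^s\<close>,
  \<open>-n \<le> s \<le> n\<close>.
\<close>
definition Psi :: "complex \<Rightarrow> complex \<Rightarrow> complex \<Rightarrow> complex" where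
  "Psi A c d = qpoch (c * d / A / q ^ n) q (2 * n + 1) * LL A c d
     + (qpoch (A / c) q (2 * n + 1) * qpoch (A / d) q (2 * n + 1) * h n * (c * d / A) ^ (n + 1)
          * (\<Sum>k\<le>n. h k / p ^ (2 * k) * N k c * N k d * N k (c * d / A / q ^ n))
        - qpoch c q (2 * n + 1) * qpoch d q (2 * n + 1)
          * (\<Sum>k\<le>n. h k / p ^ k * N k (A / c) * N k (A / d) * N (n - k) (c * d / A / q ^ n)))
       / qpoch A q (n + 1)"

lemma Psi_commute: "Psi A c d = Psi A d c"
  by (simp add: Psi_def LL_def mult_ac)

text \<open>The factor (cd/(A q^n);q)_(2n+1) contains all denominators of both sums. Those of the
  first sum involve A/(cd) and need a reflection; those of the second are already blocks of n + 1
  factors in cd/A, starting at index n - k.\<close>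

lemma Psi_conv:
  assumes "A \<noteq> 0" "c \<noteq> 0" "d \<noteq> 0" and D: "qpoch (c * d / A / q ^ n) q (2 * n + 1) \<noteq> 0"
  shows "Psi A c d = qpoch (c * d / A / q ^ n) q (2 * n + 1) * (LL A c d - TT A c d - TT A (A / c) (A / d))"
proof -
  define y where "y = c * d / A"
  define D where "D = qpoch (y / q ^ n) q (2 * n + 1)"
  have y: "y \<noteq> 0" using assms by (simp add: y_def)
  have D0: "D \<noteq> 0" using assms(4) by (simp add: D_def y_def)
  have 1: "h k / p ^ (2 * k) * N k (y / q ^ n) * (- h n) * y ^ (n + 1)
      = D * (h k / p ^ k / qpoch (A / (c * d * q ^ k)) q (n + 1))" if "k \<le> n" for k
  proof -
    define Y where "Y = y * q ^ k / q ^ n"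
    have Y: "Y \<noteq> 0" using y q_nz by (simp add: Y_def)
    have ND: "N k (y / q ^ n) * qpoch Y q (n + 1) = D"
      using N_mult[OF that, of "y / q ^ n"] by (simp add: Y_def D_def mult_ac)
    have "1 / (Y * q ^ n) = A / (c * d * q ^ k)"
      using assms q_nz by (simp add: Y_def y_def)
    hence R: "qpoch (A / (c * d * q ^ k)) q (n + 1) * Y ^ (n + 1) = - h n * qpoch Y q (n + 1)"
      using qpoch_reflect[OF q_nz Y, of n] unfolding reflection_sign by simp
    have "Y ^ (n + 1) = y ^ (n + 1) * (q ^ (n + 1)) ^ k / (q ^ (n + 1)) ^ n"
      unfolding Y_def power_divide power_mult_distrib power_power_swap[of q _ "n + 1"] ..
    moreover have "q ^ (n + 1) = 1 / p"
      using b_eq b_nz q_nz by (simp add: p_def field_simps)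
    ultimately have Yn: "Y ^ (n + 1) = y ^ (n + 1) * p ^ n / p ^ k"
      using p_nz by (simp add: power_divide)
    have "qpoch Y q (n + 1) \<noteq> 0" using ND D0 by auto
    hence nz: "qpoch (A / (c * d * q ^ k)) q (n + 1) \<noteq> 0"
      using R h_n_nz by auto
    \<comment> \<open>\<open>h n ^ 2 = p ^ n\<close> lets the sign product of the reflection cancel
      against the powers of \<open>p\<close>.\<close>
    have "p ^ n * qpoch Y q (n + 1) = h n * (h n * qpoch Y q (n + 1))"
      by (simp only: h_n_squared[symmetric] power2_eq_square mult.assoc)
    also have "\<dots> = - h n * (qpoch (A / (c * d * q ^ k)) q (n + 1) * (y ^ (n + 1) * p ^ n / p ^ k))"
      using R unfolding Yn by simp
    also have "\<dots> = p ^ n * (- h n * qpoch (A / (c * d * q ^ k)) q (n + 1) * y ^ (n + 1) / p ^ k)"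
      by simp
    finally have "p ^ n * qpoch Y q (n + 1) = p ^ n * (- h n * qpoch (A / (c * d * q ^ k)) q (n + 1) * y ^ (n + 1) / p ^ k)" .
    hence "qpoch Y q (n + 1) = - h n * qpoch (A / (c * d * q ^ k)) q (n + 1) * y ^ (n + 1) / p ^ k"
      using p_nz by (metis mult_left_cancel power_not_zero)
    thus ?thesis
      unfolding ND[symmetric] using nz by (simp add: mult_2 power_add)
  qed
  have 2: "h k / p ^ k * N (n - k) (y / q ^ n)
      = D * (h k / p ^ k / qpoch (A / (A / c * (A / d) * q ^ k)) q (n + 1))" if "k \<le> n" for k
  proof -
    have *: "A / (A / c * (A / d) * q ^ k) = y / q ^ n * q ^ (n - k)"
      using assms q_nz that by (simp add: y_def power_diff)
    have ND: "N (n - k) (y / q ^ n) * qpoch (A / (A / c * (A / d) * q ^ k)) q (n + 1) = D"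
      using N_mult[of "n - k" "y / q ^ n"] unfolding * D_def by simp
    hence "N (n - k) (y / q ^ n) = D / qpoch (A / (A / c * (A / d) * q ^ k)) q (n + 1)"
      using D0 by (metis mult_zero_right nonzero_mult_div_cancel_right)
    thus ?thesis
      by simp
  qed
  have "(\<Sum>k\<le>n. h k / p ^ (2 * k) * N k c * N k d * N k (y / q ^ n)) * (- h n * y ^ (n + 1))
      = D * (\<Sum>k\<le>n. h k / p ^ k * N k c * N k d / qpoch (A / (c * d * q ^ k)) q (n + 1))"
    unfolding sum_distrib_left sum_distrib_right
  proof (intro sum.cong refl)
    fix k assume "k \<in> {..n}"
    thus "h k / p ^ (2 * k) * N k c * N k d * N k (y / q ^ n) * (- h n * y ^ (n + 1))
      = D * (h k / p ^ k * N k c * N k d / qpoch (A / (c * d * q ^ k)) q (n + 1))"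
      using arg_cong[OF 1[of k], of "\<lambda>x. x * (N k c * N k d)"] by (simp add: mult_ac)
  qed
  moreover have "D * (X / Z * T) = - (X * hn * yy * U) / Z" if "U * (- hn * yy) = D * T" for X Z T hn yy U :: complex
  proof -
    have "D * (X / Z * T) = X / Z * (D * T)" by simp
    thus ?thesis unfolding that[symmetric] by simp
  qed
  ultimately have T1: "D * TT A c d = - (qpoch (A / c) q (2 * n + 1) * qpoch (A / d) q (2 * n + 1) * h n * y ^ (n + 1)
          * (\<Sum>k\<le>n. h k / p ^ (2 * k) * N k c * N k d * N k (y / q ^ n))) / qpoch A q (n + 1)"
    unfolding TT_def by blast
  have "(\<Sum>k\<le>n. h k / p ^ k * N k (A / c) * N k (A / d) * N (n - k) (y / q ^ n))
      = D * (\<Sum>k\<le>n. h k / p ^ k * N k (A / c) * N k (A / d) / qpoch (A / (A / c * (A / d) * q ^ k)) q (n + 1))"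
    unfolding sum_distrib_left
  proof (intro sum.cong refl)
    fix k assume "k \<in> {..n}"
    thus "h k / p ^ k * N k (A / c) * N k (A / d) * N (n - k) (y / q ^ n)
      = D * (h k / p ^ k * N k (A / c) * N k (A / d) / qpoch (A / (A / c * (A / d) * q ^ k)) q (n + 1))"
      using arg_cong[OF 2[of k], of "\<lambda>x. x * (N k (A / c) * N k (A / d))"] by (simp add: mult_ac)
  qed
  hence T2: "D * TT A (A / c) (A / d) = qpoch c q (2 * n + 1) * qpoch d q (2 * n + 1)
          * (\<Sum>k\<le>n. h k / p ^ k * N k (A / c) * N k (A / d) * N (n - k) (y / q ^ n)) / qpoch A q (n + 1)"
    using assms(1-3) by (simp add: TT_def mult_ac)
  show ?thesis
    unfolding Psi_def y_def[symmetric] D_def[symmetric] right_diff_distrib T1 T2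
    by (simp add: diff_divide_distrib)
qed

text \<open>At cd = A q^(n-i) the left-hand side drops out. The substitution k' = k + n - i then
  matches the two sums term by term, since d q^k = (A/c) q^k' and c q^k = (A/d) q^k'.\<close>

lemma Psi_residue:
  assumes "A \<noteq> 0" "c \<noteq> 0" "d \<noteq> 0" and cd: "c * d / A / q ^ n = 1 / q ^ i" and i: "i \<le> 2 * n"
  shows "Psi A c d = 0"
proof -
  obtain \<nu> where \<nu>: "\<And>k. k \<le> n \<Longrightarrow> N k (1 / q ^ i) = \<nu> * hh i k * p ^ k"
    using N_at_q_power[OF i] by blast
  have D0: "qpoch (1 / q ^ i) q (2 * n + 1) = 0"
    using i q_nz by (auto simp: qpoch_eq_0_iff intro!: exI[of _ i])
  have cd': "c * d * q ^ i = A * q ^ n"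
    using cd assms q_nz by (simp add: field_simps)
  \<comment> \<open>Both sides are the product of the two full factorials divided by the same block
    of n + 1 factors, written so that the block may vanish.\<close>
  have swap: "qpoch z q (2 * n + 1) * N k' w = qpoch w q (2 * n + 1) * N k z"
    if "k \<le> n" "k' \<le> n" "z * q ^ k = w * q ^ k'" for z w k k'
    unfolding N_mult[OF that(1), of z, symmetric] N_mult[OF that(2), of w, symmetric] that(3) by simp
  \<comment> \<open>\<open>I\<close> and \<open>I'\<close> collect the indices whose partner under
    k' = k + n - i also lies in 0..n; all other terms vanish because \<open>hh\<close> does.\<close>
  define I where "I = {k. k \<le> n \<and> k \<le> i \<and> i \<le> n + k}"
  define I' where "I' = {k. k \<le> n \<and> n \<le> i + k \<and> i + k \<le> 2 * n}"
  define Q where "Q = (\<lambda>x. qpoch x q (2 * n + 1))"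
  have p_power: "p ^ i = (c * d / A) ^ (n + 1) * p ^ n"
  proof -
    have "c * d / A = q ^ n / q ^ i"
      using cd q_nz by (simp add: field_simps)
    hence "(c * d / A) ^ (n + 1) = (q ^ (n + 1)) ^ n / (q ^ (n + 1)) ^ i"
      unfolding power_power_swap[of q "n + 1"] by (simp only: power_divide)
    moreover have "q ^ (n + 1) = 1 / p"
      using b_eq b_nz q_nz by (simp add: p_def field_simps)
    ultimately show ?thesis
      using p_nz by (simp add: power_divide)
  qed
  have "Q c * Q d * (\<Sum>k\<le>n. h k / p ^ k * N k (A / c) * N k (A / d) * N (n - k) (1 / q ^ i))
      = Q c * Q d * (\<Sum>k\<in>I'. h k / p ^ k * N k (A / c) * N k (A / d) * N (n - k) (1 / q ^ i))"
  proof (intro arg_cong[of _ _ "\<lambda>x. Q c * Q d * x"] sum.mono_neutral_right ballI)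
    fix k assume k: "k \<in> {..n} - I'"
    hence "hh i (n - k) = 0"
      using h_eq_0_iff[of "i - (n - k)"] by (auto simp: I'_def hh_def)
    thus "h k / p ^ k * N k (A / c) * N k (A / d) * N (n - k) (1 / q ^ i) = 0"
      using \<nu>[of "n - k"] k by simp
  qed (auto simp: I'_def)
  also have "\<dots> = (\<Sum>k\<in>I. Q (A / c) * Q (A / d) * h n * (c * d / A) ^ (n + 1) * (h k / p ^ (2 * k) * N k c * N k d * N k (1 / q ^ i)))"
    unfolding sum_distrib_left
  proof (rule sum.reindex_bij_witness[of _ "\<lambda>k. k + n - i" "\<lambda>k. k + i - n"])
    fix k' assume k': "k' \<in> I'"
    define k where "k = k' + i - n"
    have k: "k \<le> n" "k \<le> i" "k' \<le> n" "k' = n - (i - k)" "n - k' = i - k" "i - k \<le> n" "k + n = k' + i"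
      using k' by (auto simp: I'_def k_def)
    have z: "d * q ^ k = A / c * q ^ k'" "c * q ^ k = A / d * q ^ k'"
    proof -
      have qq: "q ^ i * q ^ k' = q ^ k * q ^ n"
        using k(7) by (metis power_add add.commute)
      have "c * d * q ^ k * q ^ n = (c * d * q ^ i) * q ^ k'"
        using qq by (simp add: mult.assoc)
      also have "\<dots> = A * q ^ k' * q ^ n"
        unfolding cd' by simp
      finally have "c * d * q ^ k * q ^ n = A * q ^ k' * q ^ n" .
      hence "c * d * q ^ k = A * q ^ k'"
        using q_nz by simp
      thus "d * q ^ k = A / c * q ^ k'" "c * q ^ k = A / d * q ^ k'"
        using assms(2,3) by (simp_all add: field_simps)
    qed
    have QN: "Q d * N k' (A / c) = Q (A / c) * N k d" "Q c * N k' (A / d) = Q (A / d) * N k c"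
      unfolding Q_def using swap k(1,3) z by blast+
    have hk': "h k' = h n * h (i - k) / p ^ (i - k)"
      unfolding k(4) using k(6) by (rule h_reflect)
    have Nn: "N (n - k') (1 / q ^ i) = \<nu> * h k * p ^ (i - k)"
      using \<nu>[of "n - k'"] k(2,6) unfolding k(5) by (simp add: hh_def)
    have pp: "p ^ i = p ^ k * p ^ (i - k)" "p ^ n = p ^ k' * p ^ (i - k)"
      using k by (simp_all flip: power_add)
    have pk': "p ^ k' = p ^ n / p ^ (i - k)"
      using pp p_nz by simp
    have pw: "p ^ k * p ^ (i - k) = (c * d / A) ^ (n + 1) * p ^ n"
      using p_power pp by simp
    have "Q c * Q d * (h k' / p ^ k' * N k' (A / c) * N k' (A / d) * N (n - k') (1 / q ^ i))
        = (Q d * N k' (A / c)) * (Q c * N k' (A / d)) * (h k' / p ^ k' * N (n - k') (1 / q ^ i))"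
      by simp
    also have "h k' / p ^ k' * N (n - k') (1 / q ^ i) = h n * (c * d / A) ^ (n + 1) * (h k / p ^ (2 * k)) * N k (1 / q ^ i)"
    proof -
      have "h k' / p ^ k' * N (n - k') (1 / q ^ i) = h n * h (i - k) / p ^ k' * \<nu> * h k"
        unfolding hk' Nn using p_nz by simp
      also have "\<dots> = h n * h (i - k) * \<nu> * h k * (p ^ k * p ^ (i - k)) / (p ^ k * p ^ n)"
        unfolding pk' using p_nz by simp
      also have "\<dots> = h n * h (i - k) * \<nu> * h k * (c * d / A) ^ (n + 1) / p ^ k"
        unfolding pw using p_nz by simp
      also have "\<dots> = h n * (c * d / A) ^ (n + 1) * (h k / p ^ (2 * k)) * N k (1 / q ^ i)"
        using k p_nz by (subst \<nu>) (simp_all add: hh_def mult_2 power_add)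
      finally show ?thesis .
    qed
    finally show "Q (A / c) * Q (A / d) * h n * (c * d / A) ^ (n + 1) * (h (k' + i - n) / p ^ (2 * (k' + i - n)) * N (k' + i - n) c * N (k' + i - n) d * N (k' + i - n) (1 / q ^ i))
       = Q c * Q d * (h k' / p ^ k' * N k' (A / c) * N k' (A / d) * N (n - k') (1 / q ^ i))"
      unfolding QN k_def[symmetric] by simp
  qed (auto simp: I_def I'_def)
  also have "\<dots> = Q (A / c) * Q (A / d) * h n * (c * d / A) ^ (n + 1) * (\<Sum>k\<in>I. h k / p ^ (2 * k) * N k c * N k d * N k (1 / q ^ i))"
    by (simp add: sum_distrib_left)
  also have "(\<Sum>k\<in>I. h k / p ^ (2 * k) * N k c * N k d * N k (1 / q ^ i))
      = (\<Sum>k\<le>n. h k / p ^ (2 * k) * N k c * N k d * N k (1 / q ^ i))"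
  proof (intro sum.mono_neutral_left ballI)
    fix k assume k: "k \<in> {..n} - I"
    hence "hh i k = 0"
      using h_eq_0_iff[of "i - k"] by (auto simp: I_def hh_def)
    thus "h k / p ^ (2 * k) * N k c * N k d * N k (1 / q ^ i) = 0"
      using \<nu>[of k] k by simp
  qed (auto simp: I_def)
  finally show ?thesis
    unfolding Psi_def cd D0 Q_def by simp
qed

text \<open>The factor c^n clears the powers of 1/c in \<open>N k (A / c)\<close>; together with
  (cd/A)^(n+1) it gives c^(2n+1), which clears (A/c;q)_(2n+1). Each of the three summands then has
  degree at most (2n+1) + n + n.\<close>

lemma Psi_poly_bound:
  assumes "A \<noteq> 0" "d \<noteq> 0"
  shows "poly_bound (4 * n + 1) (\<lambda>c. c ^ n * Psi A c d)"
proof -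
  have N1: "poly_bound n (\<lambda>c. N k (c * t))" if "k \<le> n" for k t
    using poly_bound_mult[OF poly_bound_qpoch[of k t q] poly_bound_qpoch[of "n - k" "t * q ^ (n + 1 + k)" q]] that
    by (simp add: N_def mult_ac)
  have N2: "poly_bound n (\<lambda>c. c ^ n * N k (A / c))" if "k \<le> n" for k
  proof -
    have "c ^ k * qpoch (A / c) q k * (c ^ (n - k) * qpoch (A * q ^ (n + 1 + k) / c) q (n - k)) = c ^ n * N k (A / c)" for c
    proof -
      have "c ^ n = c ^ k * c ^ (n - k)" using that by (simp flip: power_add)
      thus ?thesis by (simp add: N_def)
    qed
    thus ?thesis
      using poly_bound_mult[OF poly_bound_qpoch_inverse[of k A q] poly_bound_qpoch_inverse[of "n - k" "A * q ^ (n + 1 + k)" q]] that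
      by simp
  qed
  define t where "t = d / A / q ^ n"
  have y: "c * d / A / q ^ n = c * t" for c
    by (simp add: t_def)
  have 1: "poly_bound (2 * n + 1 + (n + n)) (\<lambda>c. qpoch (c * t) q (2 * n + 1) * (\<Sum>k\<le>n. v A k * N k d * N k (A / d) * (N k (c * 1) * (c ^ n * N k (A / c)))))"
    by (intro poly_bound_mult poly_bound_qpoch poly_bound_sum poly_bound_cmult N1 N2) auto
  have 2: "poly_bound (2 * n + 1 + (n + n)) (\<lambda>c. qpoch (A / d) q (2 * n + 1) * h n * (d / A) ^ (n + 1) / qpoch A q (n + 1) *
      ((c ^ (2 * n + 1) * qpoch (A / c) q (2 * n + 1)) * (\<Sum>k\<le>n. h k / p ^ (2 * k) * N k d * (N k (c * 1) * N k (c * t)))))"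
    by (intro poly_bound_mult poly_bound_qpoch_inverse poly_bound_sum poly_bound_cmult N1) auto
  have 3: "poly_bound (2 * n + 1 + (n + n)) (\<lambda>c. - qpoch d q (2 * n + 1) / qpoch A q (n + 1) *
      (qpoch (c * 1) q (2 * n + 1) * (\<Sum>k\<le>n. h k / p ^ k * N k (A / d) * ((c ^ n * N k (A / c)) * N (n - k) (c * t)))))"
    by (intro poly_bound_mult poly_bound_qpoch poly_bound_sum poly_bound_cmult N1 N2) auto
  have eq: "qpoch (c * t) q (2 * n + 1) * (\<Sum>k\<le>n. v A k * N k d * N k (A / d) * (N k (c * 1) * (c ^ n * N k (A / c))))
     + qpoch (A / d) q (2 * n + 1) * h n * (d / A) ^ (n + 1) / qpoch A q (n + 1) *
      ((c ^ (2 * n + 1) * qpoch (A / c) q (2 * n + 1)) * (\<Sum>k\<le>n. h k / p ^ (2 * k) * N k d * (N k (c * 1) * N k (c * t))))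
     + - qpoch d q (2 * n + 1) / qpoch A q (n + 1) *
      (qpoch (c * 1) q (2 * n + 1) * (\<Sum>k\<le>n. h k / p ^ k * N k (A / d) * ((c ^ n * N k (A / c)) * N (n - k) (c * t))))
     = c ^ n * Psi A c d" for c
  proof -
    have cn: "(c * d / A) ^ (n + 1) * c ^ n = (d / A) ^ (n + 1) * c ^ (2 * n + 1)"
      by (simp add: power_divide power_mult_distrib mult_2 power_add)
    have s1: "(\<Sum>k\<le>n. v A k * N k d * N k (A / d) * (N k c * (c ^ n * N k (A / c)))) = c ^ n * LL A c d"
      by (simp add: LL_def sum_distrib_left mult_ac)
    have s2: "(\<Sum>k\<le>n. h k / p ^ k * N k (A / d) * ((c ^ n * N k (A / c)) * N (n - k) (c * t)))
        = c ^ n * (\<Sum>k\<le>n. h k / p ^ k * N k (A / c) * N k (A / d) * N (n - k) (c * t))"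
      by (simp add: sum_distrib_left mult_ac)
    have s3: "(\<Sum>k\<le>n. h k / p ^ (2 * k) * N k d * (N k c * N k (c * t)))
        = (\<Sum>k\<le>n. h k / p ^ (2 * k) * N k c * N k d * N k (c * t))"
      by (simp add: mult_ac)
    have s4: "x1 * (cn * L) + x2 * hn * y1 / x3 * ((y2 * x4) * s) + - x5 / x3 * (x6 * (cn * s'))
      = cn * (x1 * L + (x4 * x2 * hn * y3 * s - x6 * x5 * s') / x3)"
      if "y3 * cn = y1 * y2" for x1 cn L x2 hn y1 x3 y2 x4 s x5 x6 s' y3 :: complex
    proof -
      have "cn * (x1 * L + (x4 * x2 * hn * y3 * s - x6 * x5 * s') / x3)
        = x1 * (cn * L) + x2 * hn * (y3 * cn) / x3 * (x4 * s) + - x5 / x3 * (x6 * (cn * s'))"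
        by (simp add: algebra_simps diff_divide_distrib)
      thus ?thesis unfolding that by (simp add: mult_ac)
    qed
    show ?thesis
      unfolding mult_1_right unfolding Psi_def y s1 s2 s3 by (rule s4[OF cn])
  qed
  have "poly_bound (2 * n + 1 + (n + n)) (\<lambda>c. c ^ n * Psi A c d)"
    using poly_bound_add[OF poly_bound_add[OF 1 2] 3] unfolding eq .
  thus ?thesis
    by (rule poly_bound_mono) simp
qed

end

section \<open>Vanishing of \<open>Psi\<close> for generic parameters\<close>

context generic_terminating_sums
begin

lemma V_conv_v: "V k = v (a * b) k * p ^ (2 * k)"
proof -
  have 1: "a * b * q ^ (n + i) = a * q ^ i" for i
  proof -
    have "a * b * q ^ (n + i) = a * q ^ i * (b * q ^ n)" by (simp add: power_add)
    thus ?thesis by (simp add: b_eq)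
  qed
  have 3: "a * b * q ^ n = a"
    using b_eq by simp
  have 4: "p ^ (2 * k) = p ^ k * p ^ k"
    by (simp add: mult_2 power_add)
  have 2: "a * b * q ^ (2 * n + k + 1) = a * q ^ (n + k + 1)"
    using 1[of "n + k + 1"] by (simp add: mult_2 add.assoc)
  show ?thesis
    using p_nz unfolding V_def v_def 1 2 3 4 by (simp add: mult_ac)
qed

text \<open>By \<open>N_at_q_power\<close> the factors in c and d become \<open>hh\<close>, and
  those in A/c and A/d become \<open>g\<close>. Up to one common constant the two sides are thus
  \<open>S l m\<close> and \<open>G l m\<close>.\<close>

lemma LL_eq_TT_at_q_powers:
  assumes l: "l \<le> 2 * n" and m: "m \<le> 2 * n"
  shows "LL (a * b) (1 / q ^ l) (1 / q ^ m) = TT (a * b) (1 / q ^ l) (1 / q ^ m)"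
proof -
  obtain \<nu> where \<nu>: "\<And>k. k \<le> n \<Longrightarrow> N k (1 / q ^ l) = \<nu> * hh l k * p ^ k"
    using N_at_q_power[OF l] by blast
  obtain \<mu> where \<mu>: "\<And>k. k \<le> n \<Longrightarrow> N k (1 / q ^ m) = \<mu> * hh m k * p ^ k"
    using N_at_q_power[OF m] by blast
  define Q where "Q = (\<lambda>x. qpoch x q (2 * n + 1))"
  define A where "A = a * b"
  define R where "R = qpoch A q (n + 1)"
  have R: "R \<noteq> 0" using qpoch_ab_nz by (simp add: R_def A_def)
  have aq: "A * q ^ (n + 1) = a * q"
    using b_eq by (simp add: A_def)
  \<comment> \<open>Since A q^(n+1) = aq, the factorial (A;q)_(j+n+1) splits both after j and after
    n + 1 factors.\<close>
  have shift: "qpoch (A * q ^ j) q (n + 1) = R / g j" and g_nz: "g j \<noteq> 0" for j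
  proof -
    show "g j \<noteq> 0" by (simp add: g_def qpoch_ab_nz qpoch_aq_nz)
    have "qpoch A q j * qpoch (A * q ^ j) q (n + 1) = R * qpoch (a * q) q j"
      unfolding R_def aq[symmetric] qpoch_add[symmetric] by (simp add: add.commute)
    thus "qpoch (A * q ^ j) q (n + 1) = R / g j"
      using qpoch_ab_nz[of j] qpoch_aq_nz[of j] by (simp add: g_def A_def field_simps)
  qed
  have NA: "N k (A * q ^ i) = Q (A * q ^ i) / R * g (i + k)" if "k \<le> n" for i k
  proof -
    have "A * q ^ i * q ^ k = A * q ^ (i + k)" by (simp add: power_add)
    hence "N k (A * q ^ i) * (R / g (i + k)) = Q (A * q ^ i)"
      using N_mult[OF that, of "A * q ^ i"] by (simp only: shift Q_def)
    thus ?thesis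
      using R g_nz[of "i + k"] by (simp add: field_simps)
  qed
  define X where "X = \<nu> * \<mu> * Q (A * q ^ l) * Q (A * q ^ m) / R ^ 2"
  have "LL A (1 / q ^ l) (1 / q ^ m) = X * S l m"
    unfolding LL_def S_def sum_distrib_left
  proof (intro sum.cong refl)
    fix k assume k: "k \<in> {..n}"
    show "v A k * N k (1 / q ^ l) * N k (1 / q ^ m) * N k (A / (1 / q ^ l)) * N k (A / (1 / q ^ m))
        = X * (V k * (hh l k * g (l + k)) * (hh m k * g (m + k)))"
      using k by (simp add: \<nu> \<mu> NA V_conv_v X_def A_def[symmetric] power2_eq_square mult_2 power_add)
  qed
  also have "\<dots> = X * G l m"
    by (simp add: S_eq_G)
  also have "\<dots> = TT A (1 / q ^ l) (1 / q ^ m)"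
    unfolding TT_def G_def sum_distrib_left
  proof (intro sum.cong refl)
    fix k assume k: "k \<in> {..n}"
    show "X * (p ^ k * h k * hh l k * hh m k * g (l + m - k))
        = qpoch (A / (1 / q ^ l)) q (2 * n + 1) * qpoch (A / (1 / q ^ m)) q (2 * n + 1) / qpoch A q (n + 1)
         * (h k / p ^ k * N k (1 / q ^ l) * N k (1 / q ^ m) / qpoch (A / (1 / q ^ l * (1 / q ^ m) * q ^ k)) q (n + 1))"
    proof (cases "k \<le> l")
      case True
      hence *: "A / (1 / q ^ l * (1 / q ^ m) * q ^ k) = A * q ^ (l + m - k)"
        using q_nz by (simp add: power_diff power_add)
      have "qpoch (A / (1 / q ^ l * (1 / q ^ m) * q ^ k)) q (n + 1) = R / g (l + m - k)"
        unfolding * by (rule shift)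
      thus ?thesis
        using k p_nz by (simp add: \<nu> \<mu> X_def Q_def R_def power2_eq_square)
    qed (use k in \<open>simp add: \<nu> hh_def\<close>)
  qed
  finally show ?thesis
    by (simp add: A_def)
qed

text \<open>The second right-hand sum carries (c;q)_(2n+1), which is 0 at c = q^(-l).\<close>

lemma Psi_eq_0_at_q_powers:
  assumes l: "l \<le> 2 * n" and m: "m \<le> 2 * n"
  shows "Psi (a * b) (1 / q ^ l) (1 / q ^ m) = 0"
proof -
  have ab: "a * b \<noteq> 0" using a_nz b_nz by simp
  have "qpoch (1 / q ^ l * (1 / q ^ m) / (a * b) / q ^ n) q (2 * n + 1) \<noteq> 0"
  proof
    assume "qpoch (1 / q ^ l * (1 / q ^ m) / (a * b) / q ^ n) q (2 * n + 1) = 0"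
    then obtain j where j: "1 / q ^ l * (1 / q ^ m) / (a * b) / q ^ n * q ^ j = 1"
      by (auto simp: qpoch_eq_0_iff)
    have aq: "a * b * q ^ n = a" using b_eq by simp
    have "1 / q ^ l * (1 / q ^ m) / (a * b) / q ^ n * q ^ j = q ^ j / ((a * b * q ^ n) * q ^ (l + m))"
      by (simp add: power_add mult_ac)
    hence "a * q ^ (l + m) = q ^ j"
      using j a_nz q_nz unfolding aq by simp
    thus False using a_generic by blast
  qed
  moreover have "TT (a * b) (a * b / (1 / q ^ l)) (a * b / (1 / q ^ m)) = 0"
  proof -
    have "qpoch (1 / q ^ l) q (2 * n + 1) = 0"
      using l q_nz by (auto simp: qpoch_eq_0_iff intro!: exI[of _ l])
    thus ?thesis using ab by (simp add: TT_def)
  qed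
  ultimately show ?thesis
    using Psi_conv[of "a * b" "1 / q ^ l" "1 / q ^ m"] ab q_nz LL_eq_TT_at_q_powers[OF l m] by simp
qed

text \<open>The 2n + 1 assumed zeros and the 2n + 1 from \<open>Psi_residue\<close> exceed the
  degree 4n + 1. Genericity of d keeps the two families disjoint.\<close>

lemma Psi_eq_0_extend:
  assumes "\<And>l. l \<le> 2 * n \<Longrightarrow> Psi (a * b) (1 / q ^ l) d = 0" and "d \<noteq> 0" "c \<noteq> 0"
    and generic: "\<And>l i :: nat. d * q ^ i \<noteq> a * q ^ l"
  shows "Psi (a * b) c d = 0"
proof -
  define Z1 where "Z1 = (\<lambda>l. 1 / q ^ l) ` {..2 * n}"
  define Z2 where "Z2 = (\<lambda>i. a / (d * q ^ i)) ` {..2 * n}"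
  have inj: "inj_on (\<lambda>i. x / q ^ i) {..2 * n}" if "x \<noteq> 0" for x
  proof (rule linorder_inj_onI)
    fix i j :: nat assume "i < j"
    hence "q ^ j = q ^ i * q ^ (j - i)" "q ^ (j - i) \<noteq> 1"
      using q_power_neq_1[of "j - i"] by (simp_all flip: power_add)
    thus "x / q ^ i \<noteq> x / q ^ j"
      using that q_nz by (simp add: field_simps)
  qed auto
  have "card Z1 = 2 * n + 1"
    using inj[of 1] by (simp add: Z1_def card_image)
  moreover have "card Z2 = 2 * n + 1"
    using inj[of "a / d"] a_nz assms(2) by (simp add: Z2_def card_image)
  moreover have "Z1 \<inter> Z2 = {}"
  proof -
    have "1 / q ^ l \<noteq> a / (d * q ^ i)" for l i
      using generic[of i l] assms(2) q_nz by (simp add: field_simps)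
    thus ?thesis by (auto simp: Z1_def Z2_def)
  qed
  ultimately have card: "card (Z1 \<union> Z2) = 4 * n + 2"
    by (subst card_Un_disjoint) (auto simp: Z1_def Z2_def)
  have ab: "a * b \<noteq> 0" using a_nz b_nz by simp
  have "c ^ n * Psi (a * b) c d = 0"
  proof (rule poly_bound_eq_0[OF Psi_poly_bound[OF ab assms(2)]])
    show "4 * n + 1 < card (Z1 \<union> Z2)" using card by simp
    fix z assume "z \<in> Z1 \<union> Z2"
    thus "z \<noteq> 0 \<and> z ^ n * Psi (a * b) z d = 0"
    proof
      assume "z \<in> Z1"
      thus ?thesis using assms(1) q_nz by (auto simp: Z1_def)
    next
      assume "z \<in> Z2"
      then obtain i where i: "i \<le> 2 * n" "z = a / (d * q ^ i)" by (auto simp: Z2_def)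
      have "a * b * q ^ n = a" using b_eq by simp
      hence "z * d / (a * b) / q ^ n = 1 / q ^ i"
        using assms(2) q_nz a_nz by (simp add: i(2) field_simps)
      moreover have "z \<noteq> 0" using i assms(2) a_nz q_nz by simp
      ultimately show ?thesis
        using Psi_residue[OF ab _ assms(2) _ i(1), of z] by simp
    qed
  qed fact
  thus ?thesis using assms(3) by simp
qed

lemma Psi_eq_0_generic:
  assumes "c \<noteq> 0" "d \<noteq> 0" and "\<And>l i :: nat. d * q ^ i \<noteq> a * q ^ l"
  shows "Psi (a * b) c d = 0"
proof (rule Psi_eq_0_extend)
  fix l assume l: "l \<le> 2 * n"
  have "Psi (a * b) d (1 / q ^ l) = 0"
  proof (rule Psi_eq_0_extend)
    fix m i :: nat
    show "1 / q ^ l * q ^ i \<noteq> a * q ^ m"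
      using a_generic[of "m + l" i] q_nz by (simp add: field_simps power_add)
  qed (use Psi_eq_0_at_q_powers l q_nz assms in auto)
  thus "Psi (a * b) (1 / q ^ l) d = 0"
    by (simp add: Psi_commute)
qed (use assms in auto)

end

context terminating_sums
begin

lemma tendsto_N [tendsto_intros]:
  "(f \<longlongrightarrow> x) F \<Longrightarrow> ((\<lambda>t. N k (f t)) \<longlongrightarrow> N k x) F"
  unfolding N_def by (intro tendsto_intros)

lemma Psi_eq_0:
  assumes A: "A \<noteq> 0" "qpoch A q (2 * n + 1) \<noteq> 0" and c: "c \<noteq> 0" and d: "d \<noteq> 0"
  shows "Psi A c d = 0"
proof (rule ccontr)
  assume neq: "Psi A c d \<noteq> 0"
  have A0: "1 - A * q ^ i \<noteq> 0" if "i \<le> 2 * n" for i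
    using A that by (auto simp: qpoch_eq_0_iff)
  have A1: "qpoch A q i \<noteq> 0" if "i \<le> 2 * n + 1" for i
    using A that by (auto simp: qpoch_eq_0_iff)
  have lim: "((\<lambda>t. Psi t c d) \<longlongrightarrow> Psi A c d) (at A)"
    unfolding Psi_def LL_def v_def using A A0 A1 p_nz q_nz qpoch_q_nz c d
    by (intro tendsto_intros) auto
  \<comment> \<open>The genericity of \<open>A\<close> excludes only countably many values, so it can be removed by continuity.\<close>
  define Bad where
    "Bad = (\<Union>i::nat. \<Union>j::nat. {q ^ j / (q ^ n * q ^ i), d * q ^ i / (q ^ n * q ^ j)}) \<union> {0}"
  have "countable Bad"
    unfolding Bad_def by (intro countable_Un countable_UN) auto
  have "\<forall>\<^sub>F t in at A. Psi t c d \<noteq> 0"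
    by (rule tendsto_imp_eventually_ne[OF lim neq])
  then obtain \<epsilon> where \<epsilon>: "\<epsilon> > 0" "\<And>t. t \<in> ball A \<epsilon> \<Longrightarrow> t \<noteq> A \<Longrightarrow> Psi t c d \<noteq> 0"
    unfolding eventually_at by (auto simp: dist_commute)
  have "\<not> ball A \<epsilon> \<subseteq> insert A Bad"
    using uncountable_ball[OF \<epsilon>(1), of A] \<open>countable Bad\<close> by (meson countable_insert countable_subset)
  then obtain t where t: "t \<in> ball A \<epsilon>" "t \<noteq> A" "t \<notin> Bad"
    by blast
  have t0: "t \<noteq> 0" and t1: "t \<noteq> q ^ j / (q ^ n * q ^ i)" and t2: "t \<noteq> d * q ^ i / (q ^ n * q ^ j)" for i j
    using t(3) unfolding Bad_def by blast+
  \<comment> \<open>The parameter a = A/b equals A q^n; it is formed here from the perturbed value t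
    of A.\<close>
  interpret generic_terminating_sums q b n "t * q ^ n"
  proof unfold_locales
    show "t * q ^ n \<noteq> 0" using t0 q_nz by simp
    show "t * q ^ n * q ^ i \<noteq> q ^ j" for i j
      using t1[of j i] q_nz by (simp add: field_simps)
  qed
  have "Psi (t * q ^ n * b) c d = 0"
  proof (rule Psi_eq_0_generic[OF c d])
    show "d * q ^ i \<noteq> t * q ^ n * q ^ l" for l i
      using t2[of i l] q_nz by (simp add: field_simps)
  qed
  moreover have "t * q ^ n * b = t" using b_eq by (simp add: mult_ac)
  ultimately show False using \<epsilon>(2)[OF t(1,2)] by simp
qed

lemma LL_eq_TT:
  assumes "A \<noteq> 0" "qpoch A q (2 * n + 1) \<noteq> 0" "c \<noteq> 0" "d \<noteq> 0"
    and "qpoch (c * d / A / q ^ n) q (2 * n + 1) \<noteq> 0"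
  shows "LL A c d = TT A c d + TT A (A / c) (A / d)"
  using Psi_conv[of A c d] Psi_eq_0[of A c d] assms by (simp add: diff_eq_eq add.commute)

end

subsection \<open>Holomorphy in \<open>1/b\<close>\<close>

lemma qpoch_tendsto_inf:
  assumes "norm q < 1"
  shows "(\<lambda>k. qpoch x q k) \<longlonglongrightarrow> qpoch_inf x q"
  unfolding qpoch_def qpoch_inf_def
  using convergent_prod_has_prod[OF convergent_prod_qpoch[OF assms]] by (rule has_prod_imp_tendsto')

lemma qpoch_nz_if_inf_nz:
  assumes "norm q < 1" "qpoch_inf x q \<noteq> 0"
  shows "qpoch x q k \<noteq> 0"
  using qpoch_mult_inf[OF assms(1), of x k] assms(2) by auto

lemma qpoch_inf_nz:
  assumes "norm q < 1" "\<And>k. qpoch x q k \<noteq> 0"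
  shows "qpoch_inf x q \<noteq> 0"
  unfolding qpoch_inf_def
proof (rule prodinf_nonzero[OF convergent_prod_qpoch[OF assms(1)]])
  show "1 - x * q ^ j \<noteq> 0" for j
    using assms(2)[of "Suc j"] by (auto simp: qpoch_Suc)
qed

lemma norm_qpoch_le:
  fixes q x :: complex
  assumes "norm q < 1"
  shows "norm (qpoch x q k) \<le> exp (norm x / (1 - norm q))"
proof -
  have "norm (qpoch x q k) \<le> (\<Prod>j<k. exp (norm x * norm q ^ j))"
    unfolding qpoch_def prod_norm[symmetric]
  proof (intro prod_mono conjI norm_ge_zero)
    fix j
    have "norm (1 - x * q ^ j) \<le> 1 + norm (x * q ^ j)"
      using norm_triangle_ineq4[of 1 "x * q ^ j"] by simp
    also have "\<dots> \<le> exp (norm x * norm q ^ j)"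
      using exp_ge_add_one_self[of "norm x * norm q ^ j"] by (simp add: norm_mult norm_power)
    finally show "norm (1 - x * q ^ j) \<le> exp (norm x * norm q ^ j)" .
  qed
  also have "\<dots> = exp (norm x * (\<Sum>j<k. norm q ^ j))"
    by (simp add: exp_sum sum_distrib_left)
  also have "(\<Sum>j<k. norm q ^ j) \<le> (\<Sum>j. norm q ^ j)"
    using assms by (intro sum_le_suminf summable_geometric) auto
  hence "exp (norm x * (\<Sum>j<k. norm q ^ j)) \<le> exp (norm x / (1 - norm q))"
    using assms mult_left_mono[of _ _ "norm x"] by (simp add: suminf_geometric divide_inverse)
  finally show ?thesis .
qed

lemma norm_qpoch_inf_le:
  assumes "norm q < 1"
  shows "norm (qpoch_inf x q) \<le> exp (norm x / (1 - norm q))"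
  using LIMSEQ_le_const2[OF tendsto_norm[OF qpoch_tendsto_inf[OF assms]]] norm_qpoch_le[OF assms] by blast

lemma holomorphic_qpoch_inf_UNIV:
  assumes "norm q < 1"
  shows "(\<lambda>x. qpoch_inf x q) holomorphic_on UNIV"
proof (rule holomorphic_uniform_sequence)
  show "(\<lambda>x. \<Prod>j<k. 1 - x * q ^ j) holomorphic_on UNIV" for k
    by (intro holomorphic_intros)
  fix z :: complex
  have "uniformly_convergent_on (cball z 1) (\<lambda>k x. \<Prod>j<k. 1 - x * q ^ j)"
  proof (rule uniformly_convergent_on_prod')
    show "uniformly_convergent_on (cball z 1) (\<lambda>k x. \<Sum>j<k. norm (1 - x * q ^ j - 1))"
    proof (rule Weierstrass_m_test')
      fix j and x assume "x \<in> cball z 1"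
      hence "norm x \<le> norm z + 1"
        using norm_triangle_ineq2[of x z] by (simp add: dist_norm norm_minus_commute)
      thus "norm (norm (1 - x * q ^ j - 1)) \<le> (norm z + 1) * norm q ^ j"
        by (simp add: norm_mult norm_power mult_right_mono)
    qed (use assms in \<open>intro summable_mult summable_geometric, auto\<close>)
  qed (auto intro!: continuous_intros)
  moreover have "lim (\<lambda>k. \<Prod>j<k. 1 - x * q ^ j) = qpoch_inf x q" for x
    using qpoch_tendsto_inf[OF assms, of x] unfolding qpoch_def by (rule limI)
  ultimately show "\<exists>d>0. cball z d \<subseteq> UNIV \<and>
      uniform_limit (cball z d) (\<lambda>k x. \<Prod>j<k. 1 - x * q ^ j) (\<lambda>x. qpoch_inf x q) sequentially"
    by (intro exI[of _ 1]) (simp add: uniformly_convergent_uniform_limit_iff)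
qed auto

lemma holomorphic_qpoch_inf [holomorphic_intros]:
  assumes "norm q < 1" "f holomorphic_on S"
  shows "(\<lambda>z. qpoch_inf (f z) q) holomorphic_on S"
  using holomorphic_on_compose_gen[OF assms(2) holomorphic_qpoch_inf_UNIV[OF assms(1)]] by (auto simp: o_def)

lemma holomorphic_qpoch [holomorphic_intros]:
  "f holomorphic_on S \<Longrightarrow> (\<lambda>z. qpoch (f z) q k) holomorphic_on S"
  unfolding qpoch_def by (intro holomorphic_intros)

lemma holomorphic_suminf_geometric:
  fixes f :: "nat \<Rightarrow> complex \<Rightarrow> complex"
  assumes hol: "\<And>k. f k holomorphic_on ball 0 R"
    and bound: "\<And>r. 0 < r \<Longrightarrow> r < R \<Longrightarrow> \<exists>C \<rho>. 0 \<le> \<rho> \<and> \<rho> < 1 \<and> (\<forall>k. \<forall>z\<in>cball 0 r. norm (f k z) \<le> C * \<rho> ^ k)"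
  shows "(\<lambda>z. \<Sum>k. f k z) holomorphic_on ball 0 R" and "\<And>z. z \<in> ball 0 R \<Longrightarrow> summable (\<lambda>k. f k z)"
proof -
  have r: "0 < (norm z + R) / 2 \<and> (norm z + R) / 2 < R \<and> norm z < (norm z + R) / 2" if "z \<in> ball 0 R" for z :: complex
    using that norm_ge_zero[of z] by (auto simp: field_simps simp del: norm_ge_zero) 
  show "(\<lambda>z. \<Sum>k. f k z) holomorphic_on ball 0 R"
  proof (rule holomorphic_uniform_sequence)
    show "(\<lambda>z. \<Sum>k<n. f k z) holomorphic_on ball 0 R" for n
      using hol by (intro holomorphic_intros) 
    fix z :: complex assume z: "z \<in> ball 0 R"
    \<comment> \<open>The midpoint of |z| and R leaves a disc around z on which the geometric bound
      is uniform.\<close>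
    define r where "r = (norm z + R) / 2"
    have r: "0 < r" "r < R" "norm z < r" using r[OF z] by (auto simp: r_def)
    obtain C \<rho> where C: "0 \<le> \<rho>" "\<rho> < 1" "\<And>k z. z \<in> cball 0 r \<Longrightarrow> norm (f k z) \<le> C * \<rho> ^ k"
      using bound[OF r(1,2)] by blast
    have sub: "cball z (r - norm z) \<subseteq> cball 0 r"
    proof
      fix x assume "x \<in> cball z (r - norm z)"
      thus "x \<in> cball 0 r"
        using norm_triangle_ineq2[of x z] by (simp add: dist_norm norm_minus_commute)
    qed
    have "uniform_limit (cball z (r - norm z)) (\<lambda>n z. \<Sum>k<n. f k z) (\<lambda>z. \<Sum>k. f k z) sequentially"
    proof (rule Weierstrass_m_test)
      show "summable (\<lambda>k. C * \<rho> ^ k)"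
        using C by (intro summable_mult summable_geometric) auto
    qed (use C sub in auto)
    moreover have "cball 0 r \<subseteq> ball (0::complex) R" using r by auto
    ultimately show "\<exists>d>0. cball z d \<subseteq> ball 0 R \<and>
        uniform_limit (cball z d) (\<lambda>n z. \<Sum>k<n. f k z) (\<lambda>z. \<Sum>k. f k z) sequentially"
      using r sub by (intro exI[of _ "r - norm z"]) auto
  qed auto
  fix z :: complex assume z: "z \<in> ball 0 R"
  then obtain C \<rho> where C: "0 \<le> \<rho>" "\<rho> < 1" "\<And>k. norm (f k z) \<le> C * \<rho> ^ k"
    using bound[of "(norm z + R) / 2"] r[OF z] by (metis mem_cball_0 less_imp_le)
  show "summable (\<lambda>k. f k z)"
  proof (rule summable_comparison_test')
    show "summable (\<lambda>k. C * \<rho> ^ k)"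
      using C by (intro summable_mult summable_geometric) auto
  qed (use C in auto)
qed

section \<open>Bounds uniform in the summation index\<close>

definition bounded_family :: "complex set \<Rightarrow> (nat \<Rightarrow> complex \<Rightarrow> complex) \<Rightarrow> bool" where
  "bounded_family S f \<longleftrightarrow> (\<exists>C. \<forall>k. \<forall>z\<in>S. norm (f k z) \<le> C)"

lemma bounded_familyI: "(\<And>k z. z \<in> S \<Longrightarrow> norm (f k z) \<le> C) \<Longrightarrow> bounded_family S f"
  unfolding bounded_family_def by blast

lemma bounded_family_const: "bounded_family S (\<lambda>k z. x)"
  by (rule bounded_familyI[of _ _ "norm x"]) simp

lemma bounded_family_ident: "bounded_family (cball 0 r) (\<lambda>k z. z)"
  by (rule bounded_familyI[of _ _ r]) simp

lemma bounded_family_mult: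
  assumes "bounded_family S f" "bounded_family S g"
  shows "bounded_family S (\<lambda>k z. f k z * g k z)"
proof -
  from assms obtain C D where "\<And>k z. z \<in> S \<Longrightarrow> norm (f k z) \<le> C" "\<And>k z. z \<in> S \<Longrightarrow> norm (g k z) \<le> D"
    unfolding bounded_family_def by blast
  hence "norm (f k z * g k z) \<le> \<bar>C\<bar> * \<bar>D\<bar>" if "z \<in> S" for k z
    using that unfolding norm_mult by (intro mult_mono) (force intro: order_trans)+
  thus ?thesis by (rule bounded_familyI)
qed

lemma bounded_family_diff:
  assumes "bounded_family S f" "bounded_family S g"
  shows "bounded_family S (\<lambda>k z. f k z - g k z)"
proof -
  from assms obtain C D where "\<And>k z. z \<in> S \<Longrightarrow> norm (f k z) \<le> C" "\<And>k z. z \<in> S \<Longrightarrow> norm (g k z) \<le> D"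
    unfolding bounded_family_def by blast
  hence "norm (f k z - g k z) \<le> C + D" if "z \<in> S" for k z
    using that norm_triangle_ineq4[of "f k z" "g k z"] by (meson add_mono order_trans)
  thus ?thesis by (rule bounded_familyI)
qed

lemma bounded_family_power: "norm q < 1 \<Longrightarrow> bounded_family S (\<lambda>k z. q ^ m k)"
  by (rule bounded_familyI[of _ _ 1]) (simp add: norm_power power_le_one)

lemma bounded_family_qpoch:
  assumes "norm q < 1" "bounded_family S u"
  shows "bounded_family S (\<lambda>k z. qpoch (u k z) q (m k))"
proof -
  obtain C where C: "\<And>k z. z \<in> S \<Longrightarrow> norm (u k z) \<le> C"
    using assms(2) unfolding bounded_family_def by blast
  have "norm (qpoch (u k z) q (m k)) \<le> exp (C / (1 - norm q))" if "z \<in> S" for k z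
    using norm_qpoch_le[OF assms(1), of "u k z" "m k"] divide_right_mono[OF C[OF that], of "1 - norm q" k] assms(1)
    by (meson diff_ge_0_iff_ge exp_le_cancel_iff less_imp_le order_trans)
  thus ?thesis by (rule bounded_familyI)
qed

lemma bounded_family_qpoch_inf:
  assumes "norm q < 1" "bounded_family S u"
  shows "bounded_family S (\<lambda>k z. qpoch_inf (u k z) q)"
proof -
  obtain C where C: "\<And>k z. z \<in> S \<Longrightarrow> norm (u k z) \<le> C"
    using assms(2) unfolding bounded_family_def by blast
  have "norm (qpoch_inf (u k z) q) \<le> exp (C / (1 - norm q))" if "z \<in> S" for k z
    using norm_qpoch_inf_le[OF assms(1), of "u k z"] divide_right_mono[OF C[OF that], of "1 - norm q" k] assms(1)
    by (meson diff_ge_0_iff_ge exp_le_cancel_iff less_imp_le order_trans)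
  thus ?thesis by (rule bounded_familyI)
qed

text \<open>The reciprocals converge, because the infinite product of nonvanishing factors is
  nonzero; hence they are bounded.\<close>

lemma bounded_family_divide_qpoch:
  assumes "norm q < 1" "\<And>k. qpoch x q k \<noteq> 0" "bounded_family S f"
  shows "bounded_family S (\<lambda>k z. f k z / qpoch x q (m k))"
proof -
  have "(\<lambda>k. inverse (qpoch x q k)) \<longlonglongrightarrow> inverse (qpoch_inf x q)"
    using assms by (intro tendsto_inverse qpoch_tendsto_inf qpoch_inf_nz)
  hence "Bseq (\<lambda>k. inverse (qpoch x q k))"
    using convergentI convergent_imp_Bseq by blast
  then obtain B where "\<And>k. norm (inverse (qpoch x q k)) \<le> B"
    unfolding Bseq_def by blast
  hence "bounded_family S (\<lambda>k z. inverse (qpoch x q (m k)))"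
    by (intro bounded_familyI)
  from bounded_family_mult[OF assms(3) this] show ?thesis
    by (simp add: divide_inverse)
qed

lemmas bounded_family_intros =
  bounded_family_const bounded_family_ident bounded_family_mult bounded_family_diff bounded_family_power
  bounded_family_qpoch bounded_family_qpoch_inf bounded_family_divide_qpoch

text \<open>
  \<open>qprod w \<beta> q k = \<beta>^k (w/\<beta>; q)\<^sub>k\<close>, written so that it makes sense at \<open>\<beta> = 0\<close>.
\<close>
definition qprod :: "complex \<Rightarrow> complex \<Rightarrow> complex \<Rightarrow> nat \<Rightarrow> complex" where
  "qprod w \<beta> q k = (\<Prod>j<k. \<beta> - w * q ^ j)"

lemma qprod_conv_qpoch:
  assumes "\<beta> \<noteq> 0"
  shows "qprod w \<beta> q k = \<beta> ^ k * qpoch (w / \<beta>) q k"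
proof -
  have "qprod w \<beta> q k = (\<Prod>j<k. \<beta> * (1 - w / \<beta> * q ^ j))"
    unfolding qprod_def using assms by (intro prod.cong) (simp_all add: field_simps)
  thus ?thesis by (simp add: prod.distrib qpoch_def)
qed

lemma holomorphic_qprod [holomorphic_intros]:
  "f holomorphic_on S \<Longrightarrow> (\<lambda>z. qprod w (f z) q k) holomorphic_on S"
  unfolding qprod_def by (intro holomorphic_intros)

text \<open>On |z| at most r each factor is at most r (1 + |w| |q|^j / r), so r^k is the exact
  growth to divide out.\<close>

lemma bounded_family_qprod:
  assumes "norm q < 1" "r > 0"
  shows "bounded_family (cball 0 r) (\<lambda>k z. qprod w z q k / of_real r ^ k)"
proof (rule bounded_familyI)
  fix k and z :: complex assume z: "z \<in> cball 0 r"
  have "norm (qprod w z q k / of_real r ^ k) = (\<Prod>j<k. norm (z - w * q ^ j) / r)"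
    using assms(2) by (simp add: qprod_def norm_divide norm_power prod_norm prod_dividef)
  also have "\<dots> \<le> (\<Prod>j<k. exp (norm w / r * norm q ^ j))"
  proof (intro prod_mono conjI)
    fix j
    have "norm (z - w * q ^ j) \<le> r + norm (w * q ^ j)"
      using z norm_triangle_ineq4[of z "w * q ^ j"] by simp
    hence "norm (z - w * q ^ j) / r \<le> 1 + norm w / r * norm q ^ j"
      using assms(2) by (simp add: norm_mult norm_power field_simps)
    also have "\<dots> \<le> exp (norm w / r * norm q ^ j)"
      by (rule exp_ge_add_one_self)
    finally show "norm (z - w * q ^ j) / r \<le> exp (norm w / r * norm q ^ j)" .
  qed (use assms in auto)
  also have "\<dots> = exp (norm w / r * (\<Sum>j<k. norm q ^ j))"
    by (simp add: exp_sum sum_distrib_left)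
  also have "(\<Sum>j<k. norm q ^ j) \<le> (\<Sum>j. norm q ^ j)"
    using assms by (intro sum_le_suminf summable_geometric) auto
  hence "(\<Sum>j<k. norm q ^ j) \<le> 1 / (1 - norm q)"
    using assms by (simp add: suminf_geometric)
  hence "norm w / r * (\<Sum>j<k. norm q ^ j) \<le> norm w / r * (1 / (1 - norm q))"
    by (rule mult_left_mono) (use assms in simp)
  hence "exp (norm w / r * (\<Sum>j<k. norm q ^ j)) \<le> exp (norm w / r * (1 / (1 - norm q)))"
    by simp
  finally show "norm (qprod w z q k / of_real r ^ k) \<le> exp (norm w / r * (1 / (1 - norm q)))" .
qed

text \<open>
  With \<open>\<beta> = 1/b\<close>, the terms of the series multiplied by those of the products \<open>(cq/b;q)\<^sub>\<infinity>\<close>, \<open>(dq/b;q)\<^sub>\<infinity>\<close>,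
  \<open>(aq/c;q)\<^sub>\<infinity>\<close>, \<open>(aq/d;q)\<^sub>\<infinity>\<close> whose finite parts occur in their denominators, and by \<open>1 - a\<close> on the left:
  this leaves no pole in \<open>\<beta>\<close>.
\<close>
definition Lterm :: "complex \<Rightarrow> complex \<Rightarrow> complex \<Rightarrow> complex \<Rightarrow> nat \<Rightarrow> complex \<Rightarrow> complex" where
  "Lterm q A c d k \<beta> = (1 - A * \<beta> * q ^ (2 * k)) * qpoch (A * \<beta>) q k * qprod 1 \<beta> q k * q ^ k
     * (qpoch c q k * qpoch_inf (c * \<beta> * q ^ (k + 1)) q) * (qpoch d q k * qpoch_inf (d * \<beta> * q ^ (k + 1)) q)
     * (qpoch (A / c) q k * qpoch_inf (A / c * \<beta> * q ^ (k + 1)) q)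
     * (qpoch (A / d) q k * qpoch_inf (A / d * \<beta> * q ^ (k + 1)) q)
     * qpoch (A * \<beta> * \<beta> * q ^ (k + 1)) q k / qpoch q q k / qpoch A q (2 * k)"

definition Rterm :: "complex \<Rightarrow> complex \<Rightarrow> complex \<Rightarrow> complex \<Rightarrow> nat \<Rightarrow> complex \<Rightarrow> complex" where
  "Rterm q A c d k \<beta> = qprod 1 \<beta> q k * qprod (c * d / A) \<beta> q k * q ^ (2 * k)
     * (qpoch c q k * qpoch_inf (c * \<beta> * q ^ (k + 1)) q) * (qpoch d q k * qpoch_inf (d * \<beta> * q ^ (k + 1)) q)
     / qpoch q q k / qpoch (c * d / A * q) q k"

text \<open>The first right-hand summand after the same clearing: 1 - a has merged with (aq;q)_inf
  into (A \<beta>;q)_inf. Replacing c, d by A/c, A/d gives the second summand.\<close>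

definition Rpart :: "complex \<Rightarrow> complex \<Rightarrow> complex \<Rightarrow> complex \<Rightarrow> complex \<Rightarrow> complex" where
  "Rpart q A c d \<beta> = qpoch_inf (A * \<beta>) q * qpoch_inf (A / c) q * qpoch_inf (A / d) q * qpoch_inf (A / (c * d) * \<beta> * q) q
     / (qpoch_inf A q * qpoch_inf (A / (c * d)) q) * (\<Sum>k. Rterm q A c d k \<beta>)"

definition defect :: "complex \<Rightarrow> complex \<Rightarrow> complex \<Rightarrow> complex \<Rightarrow> complex \<Rightarrow> complex" where
  "defect q A c d \<beta> = (\<Sum>k. Lterm q A c d k \<beta>) - Rpart q A c d \<beta> - Rpart q A (A / c) (A / d) \<beta>"

text \<open>The last two assumptions say that cd/A is no integer power of q, of either sign; this is
  invariant under passing to A/c, A/d.\<close>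

locale series_parameters =
  fixes q A c d :: complex
  assumes q_nz: "q \<noteq> 0" and q_lt_1: "norm q < 1" and A_nz: "A \<noteq> 0" and c_nz: "c \<noteq> 0" and d_nz: "d \<noteq> 0"
    and qpoch_A: "\<And>k. qpoch A q k \<noteq> 0"
    and qpoch_1: "\<And>k. qpoch (c * d / A) q k \<noteq> 0" and qpoch_2: "\<And>k. qpoch (A / (c * d)) q k \<noteq> 0"
begin

lemma norm_rq: "0 < r \<Longrightarrow> r < 1 / norm q \<Longrightarrow> norm (of_real r * q) < 1"
  using q_nz by (simp add: norm_mult field_simps)

lemma qpoch_1': "qpoch (c * d / A * q) q k \<noteq> 0"
  using qpoch_1[of "Suc k"] by (auto simp: qpoch_Suc_left)

lemma Lterm_holomorphic: "Lterm q A c d k holomorphic_on S"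
proof -
  have "(\<lambda>\<beta>. Lterm q A c d k \<beta>) holomorphic_on S"
    unfolding Lterm_def using q_lt_1 qpoch_A qpoch_self_nz[OF q_lt_1] by (intro holomorphic_intros) auto
  thus ?thesis by simp
qed

lemma Rterm_holomorphic: "Rterm q A c d k holomorphic_on S"
proof -
  have "(\<lambda>\<beta>. Rterm q A c d k \<beta>) holomorphic_on S"
    unfolding Rterm_def using q_lt_1 qpoch_1' qpoch_self_nz[OF q_lt_1] by (intro holomorphic_intros) auto
  thus ?thesis by simp
qed

lemma Lterm_bound:
  assumes r: "0 < r" "r < 1 / norm q"
  shows "\<exists>C \<rho>. 0 \<le> \<rho> \<and> \<rho> < 1 \<and> (\<forall>k. \<forall>z\<in>cball 0 r. norm (Lterm q A c d k z) \<le> C * \<rho> ^ k)"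
proof -
  define f where "f = (\<lambda>k \<beta>. (1 - A * \<beta> * q ^ (2 * k)) * qpoch (A * \<beta>) q k * (qprod 1 \<beta> q k / of_real r ^ k)
     * (qpoch c q k * qpoch_inf (c * \<beta> * q ^ (k + 1)) q) * (qpoch d q k * qpoch_inf (d * \<beta> * q ^ (k + 1)) q)
     * (qpoch (A / c) q k * qpoch_inf (A / c * \<beta> * q ^ (k + 1)) q)
     * (qpoch (A / d) q k * qpoch_inf (A / d * \<beta> * q ^ (k + 1)) q)
     * qpoch (A * \<beta> * \<beta> * q ^ (k + 1)) q k / qpoch q q k / qpoch A q (2 * k))"
  have "bounded_family (cball 0 r) f"
    unfolding f_def by (intro bounded_family_intros bounded_family_qprod q_lt_1 r qpoch_A qpoch_self_nz)
  then obtain C where C: "\<And>k z. z \<in> cball 0 r \<Longrightarrow> norm (f k z) \<le> C"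
    unfolding bounded_family_def by blast
  \<comment> \<open>The power r^k taken out of \<open>qprod\<close> combines with q^k into the
    geometric ratio r|q| < 1. \<open>Rterm\<close> has two such products and q^(2k), hence the
    squared ratio.\<close>
  have eq: "Lterm q A c d k z = f k z * (of_real r * q) ^ k" for k z
    using r by (simp add: Lterm_def f_def power_mult_distrib)
  have "norm (Lterm q A c d k z) \<le> C * norm (of_real r * q) ^ k" if "z \<in> cball 0 r" for k z
    unfolding eq norm_mult[of "f k z"] norm_power[of "of_real r * q"] by (intro mult_right_mono C that) simp
  thus ?thesis
    using norm_rq[OF r] norm_ge_zero by blast
qed

lemma Rterm_bound:
  assumes r: "0 < r" "r < 1 / norm q"
  shows "\<exists>C \<rho>. 0 \<le> \<rho> \<and> \<rho> < 1 \<and> (\<forall>k. \<forall>z\<in>cball 0 r. norm (Rterm q A c d k z) \<le> C * \<rho> ^ k)"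
proof -
  define f where "f = (\<lambda>k \<beta>. (qprod 1 \<beta> q k / of_real r ^ k) * (qprod (c * d / A) \<beta> q k / of_real r ^ k)
     * (qpoch c q k * qpoch_inf (c * \<beta> * q ^ (k + 1)) q) * (qpoch d q k * qpoch_inf (d * \<beta> * q ^ (k + 1)) q)
     / qpoch q q k / qpoch (c * d / A * q) q k)"
  have "bounded_family (cball 0 r) f"
    unfolding f_def by (intro bounded_family_intros bounded_family_qprod q_lt_1 r qpoch_1' qpoch_self_nz)
  then obtain C where C: "\<And>k z. z \<in> cball 0 r \<Longrightarrow> norm (f k z) \<le> C"
    unfolding bounded_family_def by blast
  have eq: "Rterm q A c d k z = f k z * ((of_real r * q) ^ 2) ^ k" for k z
    using r by (simp add: Rterm_def f_def power_mult_distrib mult_2 power_add power2_eq_square)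
  have "norm (Rterm q A c d k z) \<le> C * norm ((of_real r * q) ^ 2) ^ k" if "z \<in> cball 0 r" for k z
    unfolding eq norm_mult[of "f k z"] norm_power[of "(of_real r * q) ^ 2"] by (intro mult_right_mono C that) simp
  moreover have "norm ((of_real r * q) ^ 2) < 1"
    unfolding norm_power using norm_rq[OF r] by (intro power_less_one_iff[THEN iffD2]) auto
  ultimately show ?thesis
    using norm_ge_zero by blast
qed

lemma Lterm_series:
  shows "(\<lambda>z. \<Sum>k. Lterm q A c d k z) holomorphic_on ball 0 (1 / norm q)"
    and "z \<in> ball 0 (1 / norm q) \<Longrightarrow> summable (\<lambda>k. Lterm q A c d k z)"
  using holomorphic_suminf_geometric[of "Lterm q A c d" "1 / norm q", OF Lterm_holomorphic Lterm_bound] by blast+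

lemma Rterm_series:
  shows "(\<lambda>z. \<Sum>k. Rterm q A c d k z) holomorphic_on ball 0 (1 / norm q)"
    and "z \<in> ball 0 (1 / norm q) \<Longrightarrow> summable (\<lambda>k. Rterm q A c d k z)"
  using holomorphic_suminf_geometric[of "Rterm q A c d" "1 / norm q", OF Rterm_holomorphic Rterm_bound] by blast+

lemma Rpart_holomorphic: "Rpart q A c d holomorphic_on ball 0 (1 / norm q)"
proof -
  have "(\<lambda>\<beta>. Rpart q A c d \<beta>) holomorphic_on ball 0 (1 / norm q)"
    unfolding Rpart_def using qpoch_inf_nz[OF q_lt_1 qpoch_A] qpoch_inf_nz[OF q_lt_1 qpoch_2]
    by (intro holomorphic_intros Rterm_series q_lt_1) auto
  thus ?thesis by simp
qed

end

subsection \<open>Continuation from \<open>1/b = q^n\<close>\<close>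

text \<open>Used at B = q^n: it rewrites a quotient over (yq;q)_k as one over (1/(y q^k);q)_k, the
  base that occurs in \<open>TT\<close>. Each induction step is the two-factor identity labelled
  3.\<close>

lemma qprod_qpoch_swap:
  fixes q B y :: complex
  assumes "q \<noteq> 0" "y \<noteq> 0"
  shows "qprod y B q k * q ^ k * qpoch (1 / (y * q ^ k)) q k = qpoch (y * q) q k * qpoch (B * q / (y * q ^ k)) q k"
proof (induction k)
  case 0
  show ?case by (simp add: qprod_def)
next
  case (Suc k)
  have 1: "qpoch (1 / (y * q ^ Suc k)) q (Suc k) = (1 - 1 / (y * q ^ Suc k)) * qpoch (1 / (y * q ^ k)) q k"
    using assms by (subst qpoch_Suc_left) simp
  have 2: "qpoch (B * q / (y * q ^ Suc k)) q (Suc k) = (1 - B / (y * q ^ k)) * qpoch (B * q / (y * q ^ k)) q k"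
    using assms by (subst qpoch_Suc_left) simp
  have 3: "(B - y * q ^ k) * q * (1 - 1 / (y * q ^ Suc k)) = (1 - y * q * q ^ k) * (1 - B / (y * q ^ k))"
    using assms by (simp add: field_simps)
  have "qprod y B q (Suc k) * q ^ Suc k * qpoch (1 / (y * q ^ Suc k)) q (Suc k)
      = (qprod y B q k * q ^ k * qpoch (1 / (y * q ^ k)) q k) * ((B - y * q ^ k) * q * (1 - 1 / (y * q ^ Suc k)))"
    unfolding 1 by (simp add: qprod_def)
  also have "\<dots> = qpoch (y * q) q (Suc k) * qpoch (B * q / (y * q ^ Suc k)) q (Suc k)"
    unfolding Suc.IH 2 3 by (simp add: qpoch_Suc mult_ac)
  finally show ?case .
qed

context terminating_sums
begin

lemma b_conv: "b = 1 / q ^ n"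
  using b_eq q_nz by (simp add: field_simps)

lemma qprod_1: "qprod 1 (q ^ n) q k = q ^ (n * k) * qpoch b q k"
  using q_nz by (simp add: qprod_conv_qpoch b_conv power_mult)

lemma qprod_1_eq_0: "k > n \<Longrightarrow> qprod 1 (q ^ n) q k = 0"
  unfolding qprod_def by (intro prod_zero bexI[of _ n]) auto

text \<open>Cutting the infinite product at index 2n + 1 leaves a remainder independent of k, which
  can leave the sum.\<close>

lemma N_conv_qpoch_inf:
  assumes "k \<le> n"
  shows "qpoch c q k * qpoch_inf (c * q ^ n * q ^ (k + 1)) q = N k c * qpoch_inf (c * q ^ (2 * n + 1)) q"
proof -
  have eq: "n + k + 1 + (n - k) = 2 * n + 1"
    using assms by simp
  have "qpoch_inf (c * q ^ (n + k + 1)) q = qpoch (c * q ^ (n + k + 1)) q (n - k) * qpoch_inf (c * q ^ (n + k + 1) * q ^ (n - k)) q"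
    by (rule qpoch_mult_inf[OF q_lt_1, symmetric])
  also have "c * q ^ (n + k + 1) * q ^ (n - k) = c * q ^ (2 * n + 1)"
    unfolding mult.assoc power_add[symmetric] eq ..
  finally have "qpoch_inf (c * q ^ (n + k + 1)) q = qpoch (c * q ^ (n + k + 1)) q (n - k) * qpoch_inf (c * q ^ (2 * n + 1)) q" .
  moreover have "c * q ^ n * q ^ (k + 1) = c * q ^ (n + k + 1)" "n + 1 + k = n + k + 1"
    by (simp_all add: power_add)
  ultimately show ?thesis
    by (simp only: N_def mult.assoc)
qed

definition tail :: "complex \<Rightarrow> complex" where "tail c = qpoch_inf (c * q ^ (2 * n + 1)) q"

lemma p_power_inverse: "1 / p ^ k = q ^ (n * k) * q ^ k"
proof -
  have "1 / p = q ^ n * q"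
    using b_eq b_nz q_nz by (simp add: p_def field_simps)
  hence "(1 / p) ^ k = q ^ (n * k) * q ^ k"
    by (simp add: power_mult_distrib power_mult)
  thus ?thesis by (simp add: power_divide)
qed

lemma suminf_Lterm:
  assumes "1 - A * q ^ n \<noteq> 0"
  shows "(\<Sum>k. Lterm q A c d k (q ^ n)) = (1 - A * q ^ n) * (tail c * tail d * tail (A / c) * tail (A / d)) * LL A c d"
proof -
  have "(\<Sum>k. Lterm q A c d k (q ^ n)) = (\<Sum>k\<le>n. Lterm q A c d k (q ^ n))"
    using qprod_1_eq_0 by (intro suminf_finite) (auto simp: Lterm_def)
  also have "\<dots> = (1 - A * q ^ n) * (tail c * tail d * tail (A / c) * tail (A / d)) * LL A c d"
    unfolding LL_def sum_distrib_left
  proof (intro sum.cong refl)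
    fix k assume "k \<in> {..n}"
    hence k: "k \<le> n" by simp
    have pw: "A * q ^ n * q ^ n * q ^ (k + 1) = A * q ^ (2 * n + k + 1)" "A * q ^ n * q ^ (2 * k) = A * q ^ (n + 2 * k)"
      by (simp_all add: mult_2 power_add)
    have "v A k = (1 - A * q ^ (n + 2 * k)) / (1 - A * q ^ n) * (qpoch (A * q ^ n) q k * qpoch b q k / qpoch q q k)
     * (qpoch (A * q ^ (2 * n + k + 1)) q k / qpoch A q (2 * k)) * (1 / p ^ k)"
      by (simp add: v_def)
    hence v: "(1 - A * q ^ n) * v A k = (1 - A * q ^ (n + 2 * k)) * qpoch (A * q ^ n) q k * (q ^ (n * k) * qpoch b q k) * q ^ k
       * qpoch (A * q ^ (2 * n + k + 1)) q k / qpoch q q k / qpoch A q (2 * k)"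
      unfolding p_power_inverse using assms by simp
    have "Lterm q A c d k (q ^ n) = ((1 - A * q ^ n) * v A k) * ((N k c * tail c) * (N k d * tail d)
          * (N k (A / c) * tail (A / c)) * (N k (A / d) * tail (A / d)))"
      unfolding Lterm_def N_conv_qpoch_inf[OF k] tail_def pw v qprod_1 by simp
    thus "Lterm q A c d k (q ^ n) = (1 - A * q ^ n) * (tail c * tail d * tail (A / c) * tail (A / d))
        * (v A k * N k c * N k d * N k (A / c) * N k (A / d))"
      by simp
  qed
  finally show ?thesis .
qed

lemma Rpart_eq_TT:
  assumes "A \<noteq> 0" "c \<noteq> 0" "d \<noteq> 0" and A: "\<And>k. qpoch A q k \<noteq> 0"
    and y1: "\<And>k. qpoch (c * d / A) q k \<noteq> 0" and y2: "\<And>k. qpoch (A / (c * d)) q k \<noteq> 0"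
  shows "Rpart q A c d (q ^ n) = (1 - A * q ^ n) * (tail c * tail d * tail (A / c) * tail (A / d)) * TT A c d"
proof -
  define y where "y = c * d / A"
  have y_nz: "y \<noteq> 0" and y_inv: "A / (c * d) = 1 / y" and y_inv': "A / (c * d * q ^ k) = 1 / (y * q ^ k)" for k
    using assms(1-3) by (auto simp: y_def)
  have y_pow: "y * q ^ j \<noteq> 1" "q ^ j \<noteq> y" for j
    using y1[of "Suc j"] y2[of "Suc j"] y_nz unfolding y_inv y_def[symmetric] by (auto simp: qpoch_Suc)
  have nz1: "qpoch (1 / (y * q ^ k)) q j \<noteq> 0" for j k
  proof
    assume "qpoch (1 / (y * q ^ k)) q j = 0"
    then obtain i where "1 / (y * q ^ k) * q ^ i = 1" by (auto simp: qpoch_eq_0_iff)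
    hence i: "q ^ i = y * q ^ k" using y_nz q_nz by (simp add: field_simps)
    show False
    proof (cases "k \<le> i")
      case True
      hence "q ^ i = q ^ (i - k) * q ^ k" by (simp flip: power_add)
      thus False using i y_pow(2)[of "i - k"] q_nz by simp
    next
      case False
      hence "q ^ k = q ^ (k - i) * q ^ i" by (simp flip: power_add)
      thus False using i y_pow(1)[of "k - i"] q_nz by (simp add: mult.commute)
    qed
  qed
  have nz2: "qpoch (y * q) q k \<noteq> 0" for k
    using y1[of "Suc k"] unfolding y_def[symmetric] by (auto simp: qpoch_Suc_left)
  \<comment> \<open>(1/(y q^k);q)_(n+k+1) is split after k and after n + 1 factors.\<close>
  have quot: "qprod y (q ^ n) q k * q ^ k / qpoch (y * q) q k
      = qpoch (1 / y) q (n + 1) / qpoch (1 / (y * q ^ k)) q (n + 1)" for k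
  proof -
    have "qpoch (1 / (y * q ^ k)) q (k + (n + 1)) = qpoch (1 / (y * q ^ k)) q k * qpoch (1 / y) q (n + 1)"
      unfolding qpoch_add[of _ q k "n + 1"] using q_nz by simp
    moreover have "qpoch (1 / (y * q ^ k)) q ((n + 1) + k) = qpoch (1 / (y * q ^ k)) q (n + 1) * qpoch (q ^ n * q / (y * q ^ k)) q k"
      unfolding qpoch_add[of _ q "n + 1" k] by (simp add: mult_ac)
    ultimately have "qpoch (1 / (y * q ^ k)) q k * qpoch (1 / y) q (n + 1)
        = qpoch (1 / (y * q ^ k)) q (n + 1) * qpoch (q ^ n * q / (y * q ^ k)) q k"
      by (simp only: add.commute[of k])
    hence "qpoch (1 / y) q (n + 1) / qpoch (1 / (y * q ^ k)) q (n + 1) = qpoch (q ^ n * q / (y * q ^ k)) q k / qpoch (1 / (y * q ^ k)) q k"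
      using nz1[of k k] nz1[of k "n + 1"] by (simp add: field_simps)
    moreover have "qprod y (q ^ n) q k * q ^ k / qpoch (y * q) q k = qpoch (q ^ n * q / (y * q ^ k)) q k / qpoch (1 / (y * q ^ k)) q k"
      using qprod_qpoch_swap[OF q_nz y_nz, of "q ^ n" k] nz1[of k k] nz2[of k] by (simp add: field_simps)
    ultimately show ?thesis by simp
  qed
  define U where "U = (\<Sum>k\<le>n. h k / p ^ k * N k c * N k d / qpoch (A / (c * d * q ^ k)) q (n + 1))"
  have "(\<Sum>k. Rterm q A c d k (q ^ n)) = (\<Sum>k\<le>n. Rterm q A c d k (q ^ n))"
    using qprod_1_eq_0 by (intro suminf_finite) (auto simp: Rterm_def)
  also have "\<dots> = tail c * tail d * qpoch (1 / y) q (n + 1) * U"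
    unfolding U_def sum_distrib_left
  proof (intro sum.cong refl)
    fix k assume "k \<in> {..n}"
    hence k: "k \<le> n" by simp
    have "Rterm q A c d k (q ^ n) = (qprod y (q ^ n) q k * q ^ k / qpoch (y * q) q k) * (qpoch b q k / qpoch q q k * (q ^ (n * k) * q ^ k))
        * ((N k c * tail c) * (N k d * tail d))"
      unfolding Rterm_def N_conv_qpoch_inf[OF k] tail_def y_def[symmetric] qprod_1 mult_2[of k] power_add[of q k k]
      by (simp add: mult_ac)
    also have "qpoch b q k / qpoch q q k * (q ^ (n * k) * q ^ k) = h k / p ^ k"
      unfolding p_power_inverse[symmetric] by (simp add: h_def)
    finally show "Rterm q A c d k (q ^ n) = tail c * tail d * qpoch (1 / y) q (n + 1)
        * (h k / p ^ k * N k c * N k d / qpoch (A / (c * d * q ^ k)) q (n + 1))"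
      unfolding quot y_inv' by (simp add: mult_ac)
  qed
  finally have S: "(\<Sum>k. Rterm q A c d k (q ^ n)) = tail c * tail d * qpoch (1 / y) q (n + 1) * U" .
  have inf_A: "qpoch_inf A q = qpoch A q n * qpoch_inf (A * q ^ n) q"
    by (rule qpoch_mult_inf[OF q_lt_1, symmetric])
  have inf_y: "qpoch_inf (1 / y) q = qpoch (1 / y) q (n + 1) * qpoch_inf (1 / y * q ^ n * q) q"
    using qpoch_mult_inf[OF q_lt_1, of "1 / y" "n + 1"] by (simp add: mult_ac)
  have "qpoch_inf A q \<noteq> 0" "qpoch_inf (1 / y) q \<noteq> 0"
    using qpoch_inf_nz[OF q_lt_1 A] qpoch_inf_nz[OF q_lt_1 y2] by (simp_all add: y_inv)
  hence nz: "qpoch A q n \<noteq> 0" "qpoch_inf (A * q ^ n) q \<noteq> 0" "qpoch (1 / y) q (n + 1) \<noteq> 0" "qpoch_inf (1 / y * q ^ n * q) q \<noteq> 0"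
    unfolding inf_A inf_y by auto
  have inf_c: "qpoch_inf x q = qpoch x q (2 * n + 1) * tail x" for x
    unfolding tail_def by (rule qpoch_mult_inf[OF q_lt_1, symmetric])
  have A1: "qpoch A q (n + 1) = qpoch A q n * (1 - A * q ^ n)" "1 - A * q ^ n \<noteq> 0"
    using A[of "Suc n"] by (auto simp: qpoch_Suc)
  have cancel: "i1 * (x1 * t1) * (x2 * t2) * i2 / ((x3 * i1) * (x4 * i2)) * (t3 * t4 * x4 * u)
      = e * (t3 * t4 * t1 * t2) * (x1 * x2 / (x3 * e) * u)"
    if "i1 \<noteq> 0" "i2 \<noteq> 0" "x4 \<noteq> 0" "e \<noteq> 0" for i1 x1 t1 x2 t2 i2 x3 x4 t3 t4 u e :: complex
    using that by simp
  show ?thesis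
    unfolding Rpart_def S TT_def U_def[symmetric] y_inv inf_c[of "A / c"] inf_c[of "A / d"] inf_A inf_y A1(1)
    by (rule cancel) (use nz A1 in auto)
qed

end

section \<open>The identity theorem in \<beta> = 1/b\<close>

context series_parameters
begin

lemma swapped_quotients: "A / c * (A / d) / A = A / (c * d)" "A / (A / c * (A / d)) = c * d / A"
  "A / (A / c) = c" "A / (A / d) = d"
  using A_nz c_nz d_nz by auto

lemma series_parameters_swap: "series_parameters q A (A / c) (A / d)"
  using q_nz q_lt_1 A_nz c_nz d_nz qpoch_A qpoch_1 qpoch_2
  by unfold_locales (auto simp: swapped_quotients)

lemma defect_at_q_power: "defect q A c d (q ^ n) = 0"
proof -
  interpret terminating_sums q "1 / q ^ n" n
    using q_nz q_lt_1 by unfold_locales auto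
  \<comment> \<open>The factors involve (cd/A) q^(i-n) with exponents of both signs;
    \<open>qpoch_1\<close> covers i >= n and \<open>qpoch_2\<close> the rest.\<close>
  have D: "qpoch (c * d / A / q ^ n) q (2 * n + 1) \<noteq> 0"
  proof
    assume "qpoch (c * d / A / q ^ n) q (2 * n + 1) = 0"
    then obtain i where "c * d / A / q ^ n * q ^ i = 1" by (auto simp: qpoch_eq_0_iff)
    hence i: "c * d / A * q ^ i = q ^ n" using q_nz by (simp add: field_simps)
    show False
    proof (cases "n \<le> i")
      case True
      hence "q ^ i = q ^ (i - n) * q ^ n" by (simp flip: power_add)
      hence "c * d / A * q ^ (i - n) * q ^ n = 1 * q ^ n"
        using i by (simp only: mult.assoc mult_1_left)
      hence "c * d / A * q ^ (i - n) = 1"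
        using q_nz by (metis mult_right_cancel power_not_zero)
      thus False using qpoch_1[of "Suc (i - n)"] by (simp add: qpoch_Suc)
    next
      case False
      hence "q ^ n = q ^ (n - i) * q ^ i" by (simp flip: power_add)
      hence "c * d / A * q ^ i = q ^ (n - i) * q ^ i"
        using i by simp
      hence "c * d / A = q ^ (n - i)"
        using q_nz by (metis mult_right_cancel power_not_zero)
      hence "A / (c * d) * q ^ (n - i) = 1" using A_nz c_nz d_nz q_nz by (auto simp: field_simps)
      thus False using qpoch_2[of "Suc (n - i)"] by (simp add: qpoch_Suc)
    qed
  qed
  have "1 - A * q ^ n \<noteq> 0"
    using qpoch_A[of "Suc n"] by (auto simp: qpoch_Suc)
  hence L: "(\<Sum>k. Lterm q A c d k (q ^ n)) = (1 - A * q ^ n) * (tail c * tail d * tail (A / c) * tail (A / d)) * LL A c d"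
    by (rule suminf_Lterm)
  have R1: "Rpart q A c d (q ^ n) = (1 - A * q ^ n) * (tail c * tail d * tail (A / c) * tail (A / d)) * TT A c d"
    by (intro Rpart_eq_TT A_nz c_nz d_nz qpoch_A qpoch_1 qpoch_2)
  have R2: "Rpart q A (A / c) (A / d) (q ^ n)
      = (1 - A * q ^ n) * (tail c * tail d * tail (A / c) * tail (A / d)) * TT A (A / c) (A / d)"
    using Rpart_eq_TT[of A "A / c" "A / d"] A_nz c_nz d_nz qpoch_A qpoch_1 qpoch_2
    unfolding swapped_quotients by (simp add: mult_ac)
  show ?thesis
    unfolding defect_def L R1 R2 LL_eq_TT[OF A_nz qpoch_A c_nz d_nz D] by (simp add: distrib_left)
qed

text \<open>The zeros q^(n+1) accumulate at 0, which is an interior point of the disc of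
  holomorphy.\<close>

lemma defect_eq_0:
  assumes "\<beta> \<in> ball 0 (1 / norm q)"
  shows "defect q A c d \<beta> = 0"
proof (rule analytic_continuation[where f = "defect q A c d" and U = "range (\<lambda>n. q ^ Suc n)" and S = "ball 0 (1 / norm q)" and \<xi> = 0])
  have "(\<lambda>\<beta>. defect q A c d \<beta>) holomorphic_on ball 0 (1 / norm q)"
    unfolding defect_def
  proof (intro holomorphic_intros)
    show "(\<lambda>\<beta>. \<Sum>k. Lterm q A c d k \<beta>) holomorphic_on ball 0 (1 / norm q)"
      by (rule Lterm_series)
    show "(\<lambda>\<beta>. Rpart q A c d \<beta>) holomorphic_on ball 0 (1 / norm q)"
      using Rpart_holomorphic by simp
    show "(\<lambda>\<beta>. Rpart q A (A / c) (A / d) \<beta>) holomorphic_on ball 0 (1 / norm q)"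
      using series_parameters.Rpart_holomorphic[OF series_parameters_swap] by simp
  qed
  thus "defect q A c d holomorphic_on ball 0 (1 / norm q)" by simp
  show "(0::complex) islimpt range (\<lambda>n. q ^ Suc n)"
    unfolding islimpt_sequential
  proof (intro exI[of _ "\<lambda>n. q ^ Suc n"] conjI allI)
    show "(\<lambda>n. q ^ Suc n) \<longlonglongrightarrow> 0"
      using q_lt_1 by (intro LIMSEQ_Suc LIMSEQ_power_zero)
  qed (use q_nz in auto)
  show "range (\<lambda>n. q ^ Suc n) \<subseteq> ball 0 (1 / norm q)"
  proof
    fix z assume "z \<in> range (\<lambda>n. q ^ Suc n)"
    then obtain n where z: "z = q ^ Suc n" by auto
    have "norm z < 1" unfolding z norm_power using q_lt_1 by (intro power_Suc_less_one) (use q_nz in auto)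
    also have "1 < 1 / norm q" using q_lt_1 q_nz by simp
    finally show "z \<in> ball 0 (1 / norm q)" by simp
  qed
  show "(0::complex) \<in> ball 0 (1 / norm q)" using q_nz by simp
  show "defect q A c d z = 0" if "z \<in> range (\<lambda>n. q ^ Suc n)" for z
    using that defect_at_q_power by (auto simp del: power_Suc)
qed (use assms in auto)

end

section \<open>Return to the original parameters\<close>

theorem theoremA1:
  fixes q a b c d :: complex
  assumes "0 < norm q" and "norm q < 1"
    and "a \<noteq> 0" and "b \<noteq> 0" and "c \<noteq> 0" and "d \<noteq> 0"
    and "norm (q / b) < 1"
    and "1 - a \<noteq> 0"
    and "\<And>k. qpochs [q, a*q/b, a*q/c, a*q/d, c*q/b, d*q/b] q k \<noteq> 0"
    and "\<And>k. qpoch (a*b) q (2*k) \<noteq> 0"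
    and "qpochs_inf [a*b, a*q/c, a*q/d, a*b/(c*d)] q \<noteq> 0"
    and "\<And>k. qpochs [q, c*q/b, d*q/b, c*d*q/(a*b)] q k \<noteq> 0"
    and "qpochs_inf [a*b, c*q/b, d*q/b, c*d/(a*b)] q \<noteq> 0"
    and "\<And>k. qpochs [q, a*q/c, a*q/d, a*b*q/(c*d)] q k \<noteq> 0"
  defines "L \<equiv> (\<lambda>k. (1 - a * q ^ (2*k)) / (1 - a)
      * (qpochs [a, b, c, d, a*b/c, a*b/d] q k
         / qpochs [q, a*q/b, a*q/c, a*q/d, c*q/b, d*q/b] q k)
      * (qpoch (a*q/b) q (2*k) / qpoch (a*b) q (2*k)) * (q / b) ^ k)"
    and "R1 \<equiv> (\<lambda>k. qpochs [b, c, d, c*d/a] q k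
         / qpochs [q, c*q/b, d*q/b, c*d*q/(a*b)] q k * (q / b) ^ (2*k))"
    and "R2 \<equiv> (\<lambda>k. qpochs [b, a*b/c, a*b/d, a*b^2/(c*d)] q k
         / qpochs [q, a*q/c, a*q/d, a*b*q/(c*d)] q k * (q / b) ^ (2*k))"
  shows "summable L \<and> summable R1 \<and> summable R2 \<and>
    (\<Sum>k. L k) =
      qpochs_inf [a*q, a*b/c, a*b/d, a*q/(c*d)] q
        / qpochs_inf [a*b, a*q/c, a*q/d, a*b/(c*d)] q * (\<Sum>k. R1 k)
    + qpochs_inf [a*q, c, d, c*d*q/(a*b^2)] q
        / qpochs_inf [a*b, c*q/b, d*q/b, c*d/(a*b)] q * (\<Sum>k. R2 k)"
proof -
  define A \<beta> where "A = a * b" and "\<beta> = 1 / b"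
  have b0: "b \<noteq> 0" and c0: "c \<noteq> 0" and d0: "d \<noteq> 0" by fact+
  have A0: "A \<noteq> 0" using assms(3,4) by (simp add: A_def)
  have \<beta>0: "\<beta> \<noteq> 0" using b0 by (simp add: \<beta>_def)
  have q0: "q \<noteq> 0" and q1: "norm q < 1" using assms(1,2) by auto
  have a: "a = A * \<beta>" using b0 by (simp add: A_def \<beta>_def)
  \<comment> \<open>The condition |q/b| < 1 is membership of \<beta> in the disc of radius
    1/|q|.\<close>
  have \<beta>: "\<beta> \<in> ball 0 (1 / norm q)"
    using assms(7) q0 b0 by (simp add: \<beta>_def norm_divide field_simps)
  have nz: "qpoch_inf (A / (c * d)) q \<noteq> 0" "qpoch_inf (c * d / A) q \<noteq> 0" "qpoch_inf A q \<noteq> 0"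
    using assms(11,13) by (auto simp: qpochs_inf_def A_def)
  define Dc Dd Dc' Dd' where "Dc = qpoch_inf (c * \<beta> * q) q" and "Dd = qpoch_inf (d * \<beta> * q) q"
    and "Dc' = qpoch_inf (A / c * \<beta> * q) q" and "Dd' = qpoch_inf (A / d * \<beta> * q) q"
  have args: "c * q / b = c * \<beta> * q" "d * q / b = d * \<beta> * q" "a * q / c = A / c * \<beta> * q" "a * q / d = A / d * \<beta> * q"
    "a * b = A" "c * d / a = c * d / A / \<beta>" "a * b / c = A / c" "a * b / d = A / d" "a * b / (c * d) = A / (c * d)"
    "c * d / (a * b) = c * d / A" "c * d * q / (a * b) = c * d / A * q" "a * b * q / (c * d) = A / (c * d) * q"
    "a * b ^ 2 / (c * d) = A / (c * d) / \<beta>" "a * q / (c * d) = A / (c * d) * \<beta> * q"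
    "c * d * q / (a * b ^ 2) = c * d / A * \<beta> * q" "a * q / b = A * \<beta> * \<beta> * q"
    using b0 by (simp_all add: A_def \<beta>_def power2_eq_square)
  have D: "Dc \<noteq> 0" "Dd \<noteq> 0" "Dc' \<noteq> 0" "Dd' \<noteq> 0"
    using assms(11,13) unfolding args by (simp_all add: qpochs_inf_def Dc_def Dd_def Dc'_def Dd'_def)
  \<comment> \<open>Each finite factorial in a denominator becomes a full product, common to all k,
    divided by its tail.\<close>
  have Dsplit: "qpoch_inf (x * \<beta> * q ^ (k + 1)) q = qpoch_inf (x * \<beta> * q) q / qpoch (x * \<beta> * q) q k"
    if "qpoch_inf (x * \<beta> * q) q \<noteq> 0" for x k
    using qpoch_mult_inf[OF q1, of "x * \<beta> * q" k] qpoch_nz_if_inf_nz[OF q1 that, of k]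
    by (simp add: field_simps)
  note Dsplits = Dsplit[OF D(1)[unfolded Dc_def], folded Dc_def] Dsplit[OF D(2)[unfolded Dd_def], folded Dd_def]
    Dsplit[OF D(3)[unfolded Dc'_def], folded Dc'_def] Dsplit[OF D(4)[unfolded Dd'_def], folded Dd'_def]
  have b\<beta>: "qprod 1 \<beta> q k = \<beta> ^ k * qpoch b q k" for k
    using \<beta>0 b0 by (simp add: qprod_conv_qpoch \<beta>_def)
  have qb: "q / b = q * \<beta>"
    by (simp add: \<beta>_def)
  interpret series_parameters q A c d
    by unfold_locales (fact q0 q1 A0 c0 d0 qpoch_nz_if_inf_nz[OF q1 nz(3)] qpoch_nz_if_inf_nz[OF q1 nz(2)]
        qpoch_nz_if_inf_nz[OF q1 nz(1)])+
  note sw = swapped_quotients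
  have L: "L k = Lterm q A c d k \<beta> / ((1 - a) * (Dc * Dd * Dc' * Dd'))" for k
  proof -
    have nz2: "qpoch (A * \<beta> * \<beta> * q) q k \<noteq> 0"
      using assms(9)[of k] unfolding args by (simp add: qpochs_def)
    have "qpoch (A * \<beta> * \<beta> * q) q (2 * k) = qpoch (A * \<beta> * \<beta> * q) q k * qpoch (A * \<beta> * \<beta> * q ^ (k + 1)) q k"
      unfolding mult_2 qpoch_add by (simp add: mult_ac)
    hence quot: "qpoch (A * \<beta> * \<beta> * q ^ (k + 1)) q k = qpoch (A * \<beta> * \<beta> * q) q (2 * k) / qpoch (A * \<beta> * \<beta> * q) q k"
      using nz2 by simp
    show ?thesis
      unfolding L_def args qb Lterm_def Dsplits b\<beta> quot
      unfolding qpochs_def a[symmetric]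
      using D by (simp add: power_mult_distrib mult_ac)
  qed
  have R1: "R1 k = Rterm q A c d k \<beta> / (Dc * Dd)" for k
    unfolding R1_def args qb Rterm_def Dsplits b\<beta> qprod_conv_qpoch[OF \<beta>0, of "c * d / A"] qpochs_def
      mult_2[of k] power_add[of _ k k]
    using D by (simp add: power_mult_distrib mult_ac)
  have R2: "R2 k = Rterm q A (A / c) (A / d) k \<beta> / (Dc' * Dd')" for k
    unfolding R2_def args qb Rterm_def sw Dsplits b\<beta> qprod_conv_qpoch[OF \<beta>0, of "A / (c * d)"] qpochs_def
      mult_2[of k] power_add[of _ k k]
    using D by (simp add: power_mult_distrib mult_ac)
  have summable: "summable (\<lambda>k. Lterm q A c d k \<beta>)" "summable (\<lambda>k. Rterm q A c d k \<beta>)"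
    "summable (\<lambda>k. Rterm q A (A / c) (A / d) k \<beta>)"
    using Lterm_series(2)[OF \<beta>] Rterm_series(2)[OF \<beta>]
      series_parameters.Rterm_series(2)[OF series_parameters_swap \<beta>] by simp_all
  have "summable L" "summable R1" "summable R2"
    unfolding L R1 R2 by (intro summable_divide summable)+
  have sL: "(\<Sum>k. L k) = (\<Sum>k. Lterm q A c d k \<beta>) / ((1 - a) * (Dc * Dd * Dc' * Dd'))"
    unfolding L using summable(1) by (rule suminf_divide)
  have sR1: "(\<Sum>k. Rterm q A c d k \<beta>) = (\<Sum>k. R1 k) * (Dc * Dd)"
    unfolding R1 suminf_divide[OF summable(2)] using D by simp
  have sR2: "(\<Sum>k. Rterm q A (A / c) (A / d) k \<beta>) = (\<Sum>k. R2 k) * (Dc' * Dd')"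
    unfolding R2 suminf_divide[OF summable(3)] using D by simp
  \<comment> \<open>This absorbs the factor 1 - a by which \<open>Lterm\<close> was cleared.\<close>
  have inf_a: "qpoch_inf a q = (1 - a) * qpoch_inf (a * q) q"
    using qpoch_mult_inf[OF q1, of a 1] by (simp add: qpoch_Suc)
  have denoms: "qpochs_inf [A, A / c * \<beta> * q, A / d * \<beta> * q, A / (c * d)] q = qpoch_inf A q * Dc' * Dd' * qpoch_inf (A / (c * d)) q"
    "qpochs_inf [A, c * \<beta> * q, d * \<beta> * q, c * d / A] q = qpoch_inf A q * Dc * Dd * qpoch_inf (c * d / A) q"
    by (simp_all add: qpochs_inf_def Dc_def Dd_def Dc'_def Dd'_def)
  have "(\<Sum>k. Lterm q A c d k \<beta>) = Rpart q A c d \<beta> + Rpart q A (A / c) (A / d) \<beta>"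
    using defect_eq_0[OF \<beta>] by (simp add: defect_def algebra_simps)
  hence "(\<Sum>k. L k) = (Rpart q A c d \<beta> + Rpart q A (A / c) (A / d) \<beta>) / ((1 - a) * (Dc * Dd * Dc' * Dd'))"
    unfolding sL by simp
  also have "\<dots> = qpochs_inf [a*q, a*b/c, a*b/d, a*q/(c*d)] q
        / qpochs_inf [a*b, a*q/c, a*q/d, a*b/(c*d)] q * (\<Sum>k. R1 k)
    + qpochs_inf [a*q, c, d, c*d*q/(a*b^2)] q
        / qpochs_inf [a*b, c*q/b, d*q/b, c*d/(a*b)] q * (\<Sum>k. R2 k)"
    unfolding Rpart_def sR1 sR2 sw a[symmetric] inf_a args denoms
    using D assms(8) by (simp add: qpochs_inf_def add_divide_distrib mult_ac)
  finally show ?thesis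
    using \<open>summable L\<close> \<open>summable R1\<close> \<open>summable R2\<close> by blast
qed

end
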